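(* A sequence of $q$ $\mathrm{LCE}$ queries for a string of length $n$ over a general unordered alphabet can be executed in $\mathcal{O}(q\log n+ n\log^* n)$ time making $\mathcal{O}(n+q)$ symbol equality-tests.
   Context: A general unordered alphabet: the only operation available on symbols of the string $w=w[1..n]$ is testing whether two symbols are equal, in constant time. $\mathrm{LCE}(i,j)$ is the length of the longest common prefix of the suffixes $w[i..n]$ and $w[j..n]$. $\log^*$ is the iterated logarithm. *)

theory Defs
  imports Complex_Main "HOL-Library.Sublist"
begin

section \<open>Strings\<close>

text \<open>Positions of a string are numbered from 1, i.e. the string is \<open>w[1..n]\<close> with \<open>n = length w\<close>.\<close>

definition suffix_from :: "'a list \<Rightarrow> nat \<Rightarrow> 'a list" where
  "suffix_from w i = drop (i - 1) w"

definition LCE :: "'a list \<Rightarrow> nat \<Rightarrow> nat \<Rightarrow> nat" where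
  "LCE w i j = length (longest_common_prefix (suffix_from w i) (suffix_from w j))"

text \<open>The only access that an algorithm has to the symbols.  Off the string the answer is
  always negative, so an out-of-range test reveals nothing but the length.\<close>

definition symbol_eq :: "'a list \<Rightarrow> nat \<Rightarrow> nat \<Rightarrow> bool" where
  "symbol_eq w p q \<longleftrightarrow>
     p \<in> {1..length w} \<and> q \<in> {1..length w} \<and> w ! (p - 1) = w ! (q - 1)"

definition log_star :: "real \<Rightarrow> nat" where
  "log_star x = (LEAST k. (log 2 ^^ k) x \<le> 1)"


section \<open>A word RAM with symbol equality-tests\<close>

text \<open>Words of \<open>W\<close> bits are natural numbers below \<open>2 ^ W\<close>; every result is reduced
  modulo \<open>2 ^ W\<close>.  Registers are named by natural numbers (a program mentions only finitely many),
  and memory cells are addressed by words.  Control flow is structured instead of given by jumps,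
  which changes running times by constant factors only.\<close>

datatype binop =
  Add | Sub | Mul | Div | Mod | BitAnd | BitOr | BitXor | ShiftL | ShiftR | Less | Equal

datatype com =
    Skip
  | Const nat nat            \<comment> \<open>\<open>Const x k\<close>: \<open>x := k\<close>\<close>
  | Copy nat nat             \<comment> \<open>\<open>Copy x y\<close>: \<open>x := y\<close>\<close>
  | Binop nat binop nat nat  \<comment> \<open>\<open>Binop x f y z\<close>: \<open>x := f y z\<close>\<close>
  | Load nat nat             \<comment> \<open>\<open>Load x y\<close>: \<open>x := mem[y]\<close>\<close>
  | Store nat nat            \<comment> \<open>\<open>Store x y\<close>: \<open>mem[x] := y\<close>\<close>
  | SymEq nat nat nat        \<comment> \<open>\<open>SymEq x y z\<close>: \<open>x := 1\<close> if the symbols at positions \<open>y\<close>, \<open>z\<close> are equal, else \<open>x := 0\<close>\<close>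
  | Seq com com
  | Cond nat com com         \<comment> \<open>branch on whether the register is nonzero\<close>
  | While nat com            \<comment> \<open>loop while the register is nonzero\<close>

record state =
  reg :: "nat \<Rightarrow> nat"
  mem :: "nat \<Rightarrow> nat"

definition set_reg :: "nat \<Rightarrow> nat \<Rightarrow> state \<Rightarrow> state" where
  "set_reg x v s = s\<lparr>reg := (reg s)(x := v)\<rparr>"

definition set_mem :: "nat \<Rightarrow> nat \<Rightarrow> state \<Rightarrow> state" where
  "set_mem a v s = s\<lparr>mem := (mem s)(a := v)\<rparr>"

text \<open>Subtraction wraps around; the summand \<open>2 ^ W\<close> avoids truncation on \<open>nat\<close>.\<close>

fun binop_val :: "nat \<Rightarrow> binop \<Rightarrow> nat \<Rightarrow> nat \<Rightarrow> nat" where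
  "binop_val W Add a b = (a + b) mod 2 ^ W"
| "binop_val W Sub a b = (2 ^ W + a - b) mod 2 ^ W"
| "binop_val W Mul a b = (a * b) mod 2 ^ W"
| "binop_val W Div a b = (a div b) mod 2 ^ W"
| "binop_val W Mod a b = (a mod b) mod 2 ^ W"
| "binop_val W BitAnd a b = (and a b) mod 2 ^ W"
| "binop_val W BitOr a b = (or a b) mod 2 ^ W"
| "binop_val W BitXor a b = (xor a b) mod 2 ^ W"
| "binop_val W ShiftL a b = (push_bit b a) mod 2 ^ W"
| "binop_val W ShiftR a b = (drop_bit b a) mod 2 ^ W"
| "binop_val W Less a b = of_bool (a < b) mod 2 ^ W"
| "binop_val W Equal a b = of_bool (a = b) mod 2 ^ W"

text \<open>\<open>exec W eq c s t e s'\<close>: with word length \<open>W\<close> and equality oracle \<open>eq\<close>, program \<open>c\<close> started in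
  \<open>s\<close> halts in \<open>s'\<close> after \<open>t\<close> unit-cost steps, among which there are \<open>e\<close> symbol equality-tests.\<close>

inductive exec ::
  "nat \<Rightarrow> (nat \<Rightarrow> nat \<Rightarrow> bool) \<Rightarrow> com \<Rightarrow> state \<Rightarrow> nat \<Rightarrow> nat \<Rightarrow> state \<Rightarrow> bool"
  for W :: nat and eq :: "nat \<Rightarrow> nat \<Rightarrow> bool" where
  Skip: "exec W eq Skip s 1 0 s"
| Const: "exec W eq (Const x k) s 1 0 (set_reg x (k mod 2 ^ W) s)"
| Copy: "exec W eq (Copy x y) s 1 0 (set_reg x (reg s y) s)"
| Binop: "exec W eq (Binop x f y z) s 1 0 (set_reg x (binop_val W f (reg s y) (reg s z)) s)"
| Load: "exec W eq (Load x y) s 1 0 (set_reg x (mem s (reg s y)) s)"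
| Store: "exec W eq (Store x y) s 1 0 (set_mem (reg s x) (reg s y) s)"
| SymEq: "exec W eq (SymEq x y z) s 1 1
            (set_reg x (of_bool (eq (reg s y) (reg s z)) mod 2 ^ W) s)"
| Seq: "\<lbrakk>exec W eq c1 s t1 e1 s1; exec W eq c2 s1 t2 e2 s2\<rbrakk>
        \<Longrightarrow> exec W eq (Seq c1 c2) s (t1 + t2) (e1 + e2) s2"
| CondTrue: "\<lbrakk>reg s x \<noteq> 0; exec W eq c1 s t e s'\<rbrakk>
        \<Longrightarrow> exec W eq (Cond x c1 c2) s (t + 1) e s'"
| CondFalse: "\<lbrakk>reg s x = 0; exec W eq c2 s t e s'\<rbrakk>
        \<Longrightarrow> exec W eq (Cond x c1 c2) s (t + 1) e s'"
| WhileFalse: "reg s x = 0 \<Longrightarrow> exec W eq (While x c) s 1 0 s"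
| WhileTrue: "\<lbrakk>reg s x \<noteq> 0; exec W eq c s t1 e1 s1; exec W eq (While x c) s1 t2 e2 s2\<rbrakk>
        \<Longrightarrow> exec W eq (While x c) s (t1 + t2 + 1) (e1 + e2) s2"


section \<open>Executing a sequence of queries\<close>

text \<open>Queries are answered one after the other: query \<open>(i, j)\<close> is placed in registers 1 and 2, the
  query program is run on the state left behind by the preceding computation, and the answer is
  read off register 0.  Later queries and their number are not known to the program.\<close>

inductive serve ::
  "nat \<Rightarrow> (nat \<Rightarrow> nat \<Rightarrow> bool) \<Rightarrow> com \<Rightarrow> state \<Rightarrow> (nat \<times> nat) list \<Rightarrow> nat list \<Rightarrow> nat \<Rightarrow> nat \<Rightarrow> bool"
  for W :: nat and eq :: "nat \<Rightarrow> nat \<Rightarrow> bool" and query :: com where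
  Nil: "serve W eq query s [] [] 0 0"
| Cons: "\<lbrakk>exec W eq query (set_reg 1 i (set_reg 2 j s)) t e s';
          serve W eq query s' qs as t' e'\<rbrakk>
        \<Longrightarrow> serve W eq query s ((i, j) # qs) (reg s' 0 # as) (t + t') (e + e')"

text \<open>Initially register 0 holds the length of the string, everything else is 0.\<close>

definition init_state :: "nat \<Rightarrow> state" where
  "init_state n = \<lparr>reg = (\<lambda>_. 0)(0 := n), mem = (\<lambda>_. 0)\<rparr>"

text \<open>\<open>run_queries W prep query w qs as t e\<close>: preprocessing of \<open>w\<close> followed by the queries \<open>qs\<close> yields
  the answers \<open>as\<close> in \<open>t\<close> steps altogether, \<open>e\<close> of them symbol equality-tests.\<close>

definition run_queries ::
  "nat \<Rightarrow> com \<Rightarrow> com \<Rightarrow> 'a list \<Rightarrow> (nat \<times> nat) list \<Rightarrow> nat list \<Rightarrow> nat \<Rightarrow> nat \<Rightarrow> bool" where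
  "run_queries W prep query w qs as t e \<longleftrightarrow>
     (\<exists>s t1 e1 t2 e2.
        exec W (symbol_eq w) prep (init_state (length w)) t1 e1 s \<and>
        serve W (symbol_eq w) query s qs as t2 e2 \<and>
        t = t1 + t2 \<and> e = e1 + e2)"


section \<open>Independence of the alphabet\<close>

text \<open>A program and constants that work for all strings of natural numbers work for strings over
  every other alphabet as well, so an alphabet type that is fixed outside the choice of the program
  does not allow the program to be tailored to the alphabet.\<close>

lemma length_longest_common_prefix_map:
  assumes "inj_on f A" "set xs \<subseteq> A" "set ys \<subseteq> A"
  shows "length (longest_common_prefix (map f xs) (map f ys)) = length (longest_common_prefix xs ys)"
  using assms(2,3)
  by (induction xs ys rule: longest_common_prefix.induct)
    (auto simp: inj_on_eq_iff[OF assms(1)])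

lemma string_over_nat:
  fixes w :: "'a list"
  shows "\<exists>v :: nat list. length v = length w \<and> symbol_eq v = symbol_eq w \<and> LCE v = LCE w"
proof -
  obtain f :: "'a \<Rightarrow> nat" where f: "inj_on f (set w)"
    using finite_imp_inj_to_nat_seg[of "set w"] by auto
  have "symbol_eq (map f w) p q = symbol_eq w p q" for p q
  proof (cases "p \<in> {1..length w} \<and> q \<in> {1..length w}")
    case True
    then have "p - 1 < length w" "q - 1 < length w"
      by auto
    then show ?thesis
      by (auto simp: symbol_eq_def inj_on_eq_iff[OF f])
  next
    case False
    then show ?thesis
      by (auto simp: symbol_eq_def)
  qed
  moreover have "LCE (map f w) i j = LCE w i j" for i j
    using length_longest_common_prefix_map[OF f set_drop_subset set_drop_subset]
    by (simp add: LCE_def suffix_from_def drop_map)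
  ultimately show ?thesis
    by (intro exI[of _ "map f w"]) (auto simp: fun_eq_iff)
qed

end

(* A position is selected at level l if none of its l lowest base-3 digits is 2.  These sets are
nested, periodic modulo 3^l, contain a fraction (2/3)^l of the positions, and for any two positions
i, j some shift below 3^l takes both into the set.  Blocks of length 3^l that start at
selected positions are the elements of a union-find structure in which blocks are merged once
they have been found equal.  A query climbs through the levels while comparing blocks, and on meeting
two blocks in different classes descends into their three sub-blocks each.  Blocks compared in
full are merged, so successful symbol tests are paid by merges on level 0, and per query there is at
most one unsuccessful test and an amortised constant number of finds on each level.

Finds are by path halving with union by rank.  On the levels above O(log log n) there are so few
elements that each may pay for as many halving steps as there are ranks, and a find costs O(1).
On the lower levels ranks are grouped by the tower function, which gives O(log* n) per
find and per element; these levels are few enough for a query to touch all of them in O(log n) time. *)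

theory Submission
  imports Defs
begin

text \<open>Blocks at all positions of every level would be about \<open>n * log n\<close> elements;
  thinning makes their number linear. The thinned family must still be closed under cutting a block
  into sub-blocks, which holds because a shift by a multiple of \<open>3 ^ l\<close> leaves the
  \<open>l\<close> lowest digits alone. Base 3 is the least base that works: each of the two
  positions rules out one shift per digit, and one must be left for both.

  The obstacle in the time bound is that a query may compare many pairs inside blocks that turn out
  equal. These cannot be charged to the query, so every root holds credit for comparisons of
  sub-blocks, released when it is linked. Likewise, instead of counting the elements of each rank
  group globally, credits are fixed per rank in such a way that every link can be checked on its
  own, by the inequality \<open>cr_step\<close>.

  The term \<open>n * log_star n\<close> is thus the initial potential. No symbols are preprocessed,
  and a query is bounded by the potential it uses up plus \<open>O(log n)\<close>.\<close>

section \<open>Union-find by rank with path halving: the potential and how it changes\<close>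

text \<open>Cell \<open>u\<close> of the memory holds the parent of \<open>u\<close> (0 at a root) and cell \<open>u + off\<close> its rank.  A root of rank
  \<open>r\<close> carries credit \<open>cr l r\<close> for halving steps and \<open>al l\<close>, which is released when it is linked.
  Ranks of group \<open>grp l r\<close> end at \<open>tp l r\<close>.\<close>

locale union_find =
  fixes V :: "nat set" and lev :: "nat \<Rightarrow> nat" and off R cap :: nat
    and grp tp cr :: "nat \<Rightarrow> nat \<Rightarrow> nat" and al :: "nat \<Rightarrow> nat"
  assumes finite_V: "finite V"
    and zero_V: "0 \<notin> V"
    and V_less: "u \<in> V \<Longrightarrow> u < off"
    and grp_mono: "r \<le> r' \<Longrightarrow> r' \<le> R \<Longrightarrow> grp l r \<le> grp l r'"
    and grp_less: "tp l r < r' \<Longrightarrow> r' \<le> R \<Longrightarrow> grp l r < grp l r'"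
    and tp_le_cr: "r \<le> R \<Longrightarrow> tp l r \<le> cr l r"
    and cr_step: "r < R \<Longrightarrow> tp l r + cr l (Suc r) \<le> 2 * cr l r"
    and rank_cap: "2 ^ r \<le> cap \<Longrightarrow> r \<le> R"
begin

definition roots :: "(nat \<Rightarrow> nat) \<Rightarrow> nat \<Rightarrow> nat set" where
  "roots m l = {u \<in> V. lev u = l \<and> m u = 0}"

text \<open>The map \<open>\<rho>\<close> sends each element to the root of its tree; following parents terminates because ranks
  increase.  The last conjunct bounds ranks: a root of rank \<open>r\<close> stands for \<open>2 ^ r\<close> elements.\<close>

definition forest :: "(nat \<Rightarrow> nat) \<Rightarrow> (nat \<Rightarrow> nat) \<Rightarrow> bool" where
  "forest m \<rho> \<longleftrightarrow>
     (\<forall>u\<in>V. \<rho> u \<in> V \<and> lev (\<rho> u) = lev u \<and> m (\<rho> u) = 0 \<and> m (u + off) \<le> R \<and>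
        (m u = 0 \<longrightarrow> \<rho> u = u) \<and>
        (m u \<noteq> 0 \<longrightarrow> m u \<in> V \<and> lev (m u) = lev u \<and> \<rho> (m u) = \<rho> u \<and> m (u + off) < m (m u + off))) \<and>
     (\<forall>l. (\<Sum>u\<in>roots m l. 2 ^ m (u + off)) \<le> cap)"

text \<open>For a child, this is the room left for its parent's rank below \<open>tp\<close>, the
  end of the child's rank group. Truncated subtraction makes it 0 once the parent has left the
  group; from then on halving steps at the child are charged to the group number, which rises along
  the path.\<close>

definition phi :: "(nat \<Rightarrow> nat) \<Rightarrow> nat \<Rightarrow> nat" where
  "phi m u = (if m u = 0 then cr (lev u) (m (u + off)) + al (lev u)
              else tp (lev u) (m (u + off)) - m (m u + off))"

definition Phi :: "(nat \<Rightarrow> nat) \<Rightarrow> nat" where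
  "Phi m = (\<Sum>u\<in>V. phi m u)"

lemma finite_roots: "finite (roots m l)"
  using finite_V by (simp add: roots_def)

lemma V_neq_off: "u \<in> V \<Longrightarrow> v + off \<noteq> u" "u \<in> V \<Longrightarrow> u \<noteq> v + off"
  using V_less by fastforce+

lemma forestD:
  assumes "forest m \<rho>" "u \<in> V"
  shows "\<rho> u \<in> V" "lev (\<rho> u) = lev u" "m (\<rho> u) = 0" "m (u + off) \<le> R"
    "m u = 0 \<Longrightarrow> \<rho> u = u" "m u \<noteq> 0 \<Longrightarrow> m u \<in> V" "m u \<noteq> 0 \<Longrightarrow> lev (m u) = lev u"
    "m u \<noteq> 0 \<Longrightarrow> \<rho> (m u) = \<rho> u" "m u \<noteq> 0 \<Longrightarrow> m (u + off) < m (m u + off)"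
  using assms by (auto simp: forest_def)

text \<open>A halving step at \<open>u\<close> either decreases the potential of \<open>u\<close> or leads into a higher rank group.\<close>

lemma halve_step:
  assumes f: "forest m \<rho>" and u: "u \<in> V" "m u \<noteq> 0" "m (m u) \<noteq> 0"
  shows "forest (m(u := m (m u))) \<rho>"
    and "Phi (m(u := m (m u))) + grp (lev u) (m (u + off)) + 1
           \<le> Phi m + grp (lev u) (m (m (m u) + off))"
    and "Phi (m(u := m (m u))) \<le> Phi m"
    and "roots (m(u := m (m u))) l = roots m l"
proof -
  let ?y = "m u" and ?z = "m (m u)"
  let ?m = "m(u := ?z)"
  have y: "?y \<in> V" and z: "?z \<in> V" using forestD[OF f] u by auto
  have rky: "m (u + off) < m (?y + off)" "m (?y + off) < m (?z + off)"
    using forestD(9)[OF f] u y by auto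
  have zR: "m (?z + off) \<le> R" using forestD(4)[OF f z] .
  have lz: "lev ?z = lev u" using forestD(7)[OF f] u y by auto
  have z0: "?z \<noteq> u" using rky by auto
  have rk: "?m (w + off) = m (w + off)" for w using V_neq_off(1)[OF u(1)] by simp
  show roots: "roots ?m l = roots m l" for l using u by (auto simp: roots_def)
  have r: "\<rho> ?z = \<rho> u" using forestD(8)[OF f] u y by auto
  show "forest ?m \<rho>"
    unfolding forest_def roots
  proof (intro conjI ballI allI impI)
    fix w assume w: "w \<in> V"
    show "\<rho> w \<in> V" "lev (\<rho> w) = lev w" "?m (w + off) \<le> R"
      unfolding rk using forestD[OF f w] by auto
    show "?m (\<rho> w) = 0" using forestD(3)[OF f w] u(2) by auto
    show "\<rho> w = w" if "?m w = 0"
      using that u forestD(5)[OF f w] by (auto split: if_splits)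
    show "?m w \<in> V" "lev (?m w) = lev w" "\<rho> (?m w) = \<rho> w" if "?m w \<noteq> 0"
      using that z r lz forestD[OF f w] by (auto split: if_splits)
    show "?m (w + off) < ?m (?m w + off)" if "?m w \<noteq> 0"
      using that rky forestD(9)[OF f w] unfolding rk by (auto split: if_splits)
  next
    fix l show "(\<Sum>u\<in>roots m l. 2 ^ ?m (u + off)) \<le> cap"
      using f unfolding rk forest_def by auto
  qed
  have P: "phi ?m w = phi m w" if "w \<noteq> u" for w
    using that unfolding phi_def rk by simp
  have s: "Phi k = phi k u + (\<Sum>w\<in>V - {u}. phi k w)" for k
    unfolding Phi_def using sum.remove[OF finite_V u(1)] by blast
  have e: "(\<Sum>w\<in>V - {u}. phi ?m w) = (\<Sum>w\<in>V - {u}. phi m w)"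
    by (rule sum.cong) (auto simp: P)
  have pu: "phi ?m u = tp (lev u) (m (u + off)) - m (?z + off)"
    using u(3) unfolding phi_def rk by simp
  have pu': "phi m u = tp (lev u) (m (u + off)) - m (?y + off)"
    using u(2) unfolding phi_def by simp
  have g: "grp (lev u) (m (u + off)) \<le> grp (lev u) (m (?z + off))"
    using grp_mono[OF _ zR] rky by simp
  show "Phi ?m \<le> Phi m" unfolding s e pu pu' using rky by simp
  show "Phi ?m + grp (lev u) (m (u + off)) + 1 \<le> Phi m + grp (lev u) (m (?z + off))"
  proof (cases "tp (lev u) (m (u + off)) < m (?z + off)")
    case True
    then have "grp (lev u) (m (u + off)) < grp (lev u) (m (?z + off))"
      using grp_less zR by blast
    then show ?thesis unfolding s e pu pu' using rky by simp
  next
    case False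
    then show ?thesis unfolding s e pu pu' using rky g by simp
  qed
qed

text \<open>By \<open>rpow\<close> the two old roots outweigh the new one, so the weighted sum in
  \<open>forest\<close> does not grow. The new root's own summand \<open>2 ^ r\<close> is then at
  most \<open>cap\<close>, which gives \<open>r \<le> R\<close>.\<close>

lemma forest_link:
  assumes f: "forest m \<rho>" and u: "u \<in> V" "m u = 0" and v: "v \<in> V" "m v = 0"
    and uv: "u \<noteq> v" "lev u = lev v"
    and r: "m (u + off) \<le> m (v + off)" "m (v + off) \<le> r" "m (u + off) < r"
    and rpow: "2 ^ r \<le> (2::nat) ^ m (u + off) + 2 ^ m (v + off)"
    and m': "m' = m(u := v, v + off := r)"
    and \<rho>': "\<rho>' = (\<lambda>x. if \<rho> x = u then v else \<rho> x)"
  shows "forest m' \<rho>'" "\<And>l. roots m' l = roots m l - {u}" "r \<le> R"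
proof -
  have rk: "m' (w + off) = (if w = v then r else m (w + off))" for w
    using V_neq_off(1)[OF u(1)] by (simp add: m')
  have pa: "m' w = (if w = u then v else m w)" if "w \<in> V" for w
    using V_neq_off(2)[OF that] by (auto simp: m')
  have v0: "v \<noteq> 0" using v zero_V by metis
  show ro: "roots m' l = roots m l - {u}" for l
    using v0 by (auto simp: roots_def pa split: if_splits)
  have rv: "\<rho> v = v" and ru: "\<rho> u = u" using forestD(5)[OF f] u v by auto
  have *: "(\<Sum>w\<in>roots m' l. (2::nat) ^ m' (w + off)) \<le> cap" for l
  proof (cases "l = lev u")
    case False
    then have "roots m' l = roots m l" unfolding ro by (auto simp: roots_def)
    moreover have "m' (w + off) = m (w + off)" if "w \<in> roots m l" for w
      using that False uv unfolding rk by (auto simp: roots_def)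
    ultimately have "(\<Sum>w\<in>roots m' l. (2::nat) ^ m' (w + off)) = (\<Sum>w\<in>roots m l. (2::nat) ^ m (w + off))"
      by (auto intro: sum.cong)
    then show ?thesis using f by (auto simp: forest_def)
  next
    case True
    let ?X = "roots m l - {u} - {v}"
    have uin: "u \<in> roots m l" and vin: "v \<in> roots m l - {u}"
      using u v uv True by (auto simp: roots_def)
    have "(\<Sum>w\<in>roots m' l. (2::nat) ^ m' (w + off)) = 2 ^ r + (\<Sum>w\<in>?X. (2::nat) ^ m' (w + off))"
      unfolding ro using sum.remove[OF _ vin, of "\<lambda>w. (2::nat) ^ m' (w + off)"] finite_roots by (simp add: rk)
    also have "(\<Sum>w\<in>?X. (2::nat) ^ m' (w + off)) = (\<Sum>w\<in>?X. (2::nat) ^ m (w + off))"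
      by (rule sum.cong) (auto simp: rk)
    also have "2 ^ r + (\<Sum>w\<in>?X. (2::nat) ^ m (w + off)) \<le> 
      2 ^ m (u + off) + (2 ^ m (v + off) + (\<Sum>w\<in>?X. (2::nat) ^ m (w + off)))"
      using rpow by simp
    also have "\<dots> = (\<Sum>w\<in>roots m l. (2::nat) ^ m (w + off))"
      using sum.remove[OF _ vin, of "\<lambda>w. (2::nat) ^ m (w + off)"] 
        sum.remove[OF _ uin, of "\<lambda>w. (2::nat) ^ m (w + off)"] finite_roots by simp
    also have "\<dots> \<le> cap" using f by (auto simp: forest_def)
    finally show ?thesis .
  qed
  have vin: "v \<in> roots m' (lev v)" unfolding ro using u v uv by (auto simp: roots_def)
  have "2 ^ r \<le> (\<Sum>w\<in>roots m' (lev v). (2::nat) ^ m' (w + off))"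
    using member_le_sum[OF vin, of "\<lambda>w. (2::nat) ^ m' (w + off)"] finite_roots by (simp add: rk)
  then have "2 ^ r \<le> cap" using *[of "lev v"] by linarith
  then show rR: "r \<le> R" by (rule rank_cap)
  show "forest m' \<rho>'"
    unfolding forest_def
  proof (intro conjI ballI allI impI)
    fix w assume w: "w \<in> V"
    note fw = forestD[OF f w]
    show "\<rho>' w \<in> V" using fw v by (simp add: \<rho>')
    show "lev (\<rho>' w) = lev w" using fw uv by (auto simp: \<rho>')
    show "m' (\<rho>' w) = 0" using fw v uv pa[OF v(1)] pa[OF fw(1)] by (auto simp: \<rho>')
    show "m' (w + off) \<le> R" using fw rR by (simp add: rk)
    show "\<rho>' w = w" if "m' w = 0"
      using that v0 fw u unfolding \<rho>' by (auto simp: pa[OF w] split: if_splits)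
    show "m' w \<in> V" "lev (m' w) = lev w" if "m' w \<noteq> 0"
      using that v uv fw by (auto simp: pa[OF w] split: if_splits)
    show "\<rho>' (m' w) = \<rho>' w" if "m' w \<noteq> 0"
      using that v uv fw rv ru by (auto simp: pa[OF w] \<rho>' split: if_splits)
    show "m' (w + off) < m' (m' w + off)" if "m' w \<noteq> 0"
    proof (cases "w = u")
      case True
      then show ?thesis using r uv unfolding rk by (simp add: pa[OF u(1)])
    next
      case False
      then have "m' w = m w" "m w \<noteq> 0" using that by (auto simp: pa[OF w])
      moreover have "w \<noteq> v" using \<open>m w \<noteq> 0\<close> v by auto
      ultimately show ?thesis using fw(9) r unfolding rk by auto
    qed
  qed (rule *)
qed

text \<open>If the ranks differ, \<open>v\<close> keeps its credit and the \<open>cr\<close> of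
  \<open>u\<close> covers the \<open>tp\<close> that \<open>u\<close> needs as a child. If they are
  equal, the credits of both are pooled and \<open>cr_step\<close> applies. Either way the
  \<open>al\<close> of the linked root is left over.\<close>

lemma Phi_link:
  assumes f: "forest m \<rho>" and u: "u \<in> V" "m u = 0" and v: "v \<in> V" "m v = 0"
    and uv: "u \<noteq> v" "lev u = lev v"
    and r: "m (u + off) < m (v + off) \<and> r = m (v + off) \<or> m (u + off) = m (v + off) \<and> r = Suc (m (v + off))"
    and m': "m' = m(u := v, v + off := r)" and rR: "r \<le> R"
  shows "Phi m' + al (lev u) \<le> Phi m"
proof -
  have rk: "m' (w + off) = (if w = v then r else m (w + off))" for w
    using V_neq_off(1)[OF u(1)] by (simp add: m')
  have pa: "m' w = (if w = u then v else m w)" if "w \<in> V" for w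
    using V_neq_off(2)[OF that] by (auto simp: m')
  have v0: "v \<noteq> 0" using v zero_V by metis
  have vin: "v \<in> V - {u}" using v uv by auto
  have s: "Phi k = phi k u + (phi k v + (\<Sum>w\<in>V - {u} - {v}. phi k w))" for k
    unfolding Phi_def using sum.remove[OF finite_V u(1), of "phi k"] sum.remove[OF _ vin, of "phi k"] finite_V by simp
  \<comment> \<open>Children of \<open>v\<close> may see their parent's rank rise, which can only
    lower their potential.\<close>
  have le: "(\<Sum>w\<in>V - {u} - {v}. phi m' w) \<le> (\<Sum>w\<in>V - {u} - {v}. phi m w)"
  proof (rule sum_mono)
    fix w assume w: "w \<in> V - {u} - {v}"
    then have "m' w = m w" using pa by auto
    then show "phi m' w \<le> phi m w" using w r unfolding phi_def rk by auto
  qed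
  have pu: "phi m' u = tp (lev u) (m (u + off)) - r" using pa[OF u(1)] v0 uv unfolding phi_def rk by simp
  have pv: "phi m' v = cr (lev v) r + al (lev v)" using pa[OF v(1)] v uv unfolding phi_def rk by simp
  have qu: "phi m u = cr (lev u) (m (u + off)) + al (lev u)"
    and qv: "phi m v = cr (lev v) (m (v + off)) + al (lev v)" using u v by (auto simp: phi_def)
  have c1: "tp (lev u) (m (u + off)) \<le> cr (lev u) (m (u + off))" using tp_le_cr forestD(4)[OF f u(1)] .
  have "tp (lev u) (m (u + off)) + cr (lev u) r \<le> cr (lev u) (m (u + off)) + cr (lev u) (m (v + off))"
    using r
  proof
    assume "m (u + off) < m (v + off) \<and> r = m (v + off)"
    then show ?thesis using c1 by simp
  next
    assume *: "m (u + off) = m (v + off) \<and> r = Suc (m (v + off))"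
    then have "m (v + off) < R" using rR by simp
    then show ?thesis using * cr_step[of "m (v + off)" "lev u"] by simp
  qed
  then show ?thesis unfolding s pu pv qu qv using le uv by simp
qed

lemma link:
  assumes f: "forest m \<rho>" and u: "u \<in> V" "m u = 0" and v: "v \<in> V" "m v = 0"
    and uv: "u \<noteq> v" "lev u = lev v"
    and r: "m (u + off) < m (v + off) \<and> r = m (v + off) \<or> m (u + off) = m (v + off) \<and> r = Suc (m (v + off))"
    and m': "m' = m(u := v, v + off := r)"
    and \<rho>': "\<rho>' = (\<lambda>x. if \<rho> x = u then v else \<rho> x)"
  shows "forest m' \<rho>'" "roots m' l = roots m l - {u}" "r \<le> R" "Phi m' + al (lev u) \<le> Phi m"
proof -
  have "m (u + off) \<le> m (v + off)" "m (v + off) \<le> r" "m (u + off) < r"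
    "2 ^ r \<le> (2::nat) ^ m (u + off) + 2 ^ m (v + off)" using r by auto
  note * = forest_link[OF f u v uv this m' \<rho>']
  show "forest m' \<rho>'" "roots m' l = roots m l - {u}" "r \<le> R" using * by auto
  show "Phi m' + al (lev u) \<le> Phi m" using Phi_link[OF f u v uv r m'] * by auto
qed

end

section \<open>Towers of twos and the iterated logarithm\<close>

fun tower :: "nat \<Rightarrow> nat" where
  "tower 0 = 1"
| "tower (Suc g) = 2 ^ tower g"

definition inv_tower :: "nat \<Rightarrow> nat" where
  "inv_tower r = (LEAST g. r \<le> tower g)"

lemma pow_le_tower: "2 ^ g \<le> tower g"
proof (induction g)
  case (Suc g)
  have "g < (2::nat) ^ g" by (rule less_exp)
  with Suc have "Suc g \<le> tower g" by linarith
  then have "(2::nat) ^ Suc g \<le> 2 ^ tower g" by (intro power_increasing) auto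
  then show ?case by simp
qed simp

lemma strict_mono_tower: "strict_mono tower"
  by (rule strict_mono_Suc_iff[THEN iffD2]) (simp add: less_exp)

lemma le_tower_inv_tower: "r \<le> tower (inv_tower r)"
proof -
  have "r \<le> tower r" using pow_le_tower[of r] less_exp[of r] by linarith
  then show ?thesis unfolding inv_tower_def by (rule LeastI)
qed

lemma inv_tower_le_iff: "inv_tower r \<le> g \<longleftrightarrow> r \<le> tower g"
proof
  assume "inv_tower r \<le> g"
  then have "tower (inv_tower r) \<le> tower g"
    using strict_mono_tower by (simp add: strict_mono_less_eq)
  then show "r \<le> tower g" using le_tower_inv_tower[of r] by linarith
qed (auto simp: inv_tower_def intro: Least_le)

lemma inv_tower_mono: "r \<le> r' \<Longrightarrow> inv_tower r \<le> inv_tower r'"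
  using le_tower_inv_tower[of r'] by (simp add: inv_tower_le_iff)

lemma inv_tower_less: "tower (inv_tower r) < r' \<Longrightarrow> inv_tower r < inv_tower r'"
  using inv_tower_le_iff[of r' "inv_tower r"] by linarith

lemma inv_tower_Suc: "inv_tower (Suc r) = inv_tower r \<or> r = tower (inv_tower r) \<and> inv_tower (Suc r) = Suc (inv_tower r)"
proof (cases "Suc r \<le> tower (inv_tower r)")
  case True
  then show ?thesis using inv_tower_le_iff[of "Suc r" "inv_tower r"] inv_tower_mono[of r "Suc r"] by simp
next
  case False
  then have r: "r = tower (inv_tower r)" using le_tower_inv_tower[of r] by simp
  have "inv_tower r < inv_tower (Suc r)" using False by (intro inv_tower_less) simp
  moreover have "tower (inv_tower r) < tower (Suc (inv_tower r))"
    using strict_mono_tower by (simp add: strict_mono_less)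
  then have "inv_tower (Suc r) \<le> Suc (inv_tower r)"
    using r unfolding inv_tower_le_iff by linarith
  ultimately show ?thesis using r by linarith
qed

lemma funpow_log_le_1: "(log 2 ^^ k) x \<le> 1 \<Longrightarrow> x \<le> real (tower k)"
proof (induction k arbitrary: x)
  case (Suc k)
  then have "log 2 x \<le> real (tower k)" by (simp add: funpow_swap1)
  show ?case
  proof (cases "x > 0")
    case True
    then have "x \<le> 2 powr real (tower k)"
      using \<open>log 2 x \<le> _\<close> by (simp add: log_le_iff)
    then show ?thesis by (simp add: powr_realpow)
  next
    \<comment> \<open>Iterates may drop to 0 or below, where the logarithm says nothing; the bound
      is then trivial since towers are nonnegative.\<close>
    case False
    then show ?thesis by (simp add: order_trans[of x 0])
  qed
qed simp

text \<open>Ensures that the \<open>LEAST\<close> in \<open>log_star\<close> is attained. From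
  \<open>Suc N + 1 \<le> 2 ^ Suc N\<close>, one logarithm lowers the integer bound on
  \<open>x\<close> by at least 1.\<close>

lemma ex_funpow_log_le_1: "x \<le> real N + 1 \<Longrightarrow> \<exists>k. (log 2 ^^ k) x \<le> 1"
proof (induction N arbitrary: x)
  case 0
  then show ?case by (intro exI[of _ 0]) simp
next
  case (Suc N)
  show ?case
  proof (cases "x \<le> 1")
    case True
    then show ?thesis by (intro exI[of _ 0]) simp
  next
    case False
    have "real (Suc N + 1) \<le> real (2 ^ Suc N)"
      unfolding of_nat_le_iff using less_exp[of "Suc N"] by linarith
    then have "real (Suc N) + 1 \<le> 2 ^ Suc N" by simp
    then have "x \<le> 2 ^ Suc N" using Suc.prems by linarith
    then have "x \<le> 2 powr real (Suc N)" by (subst powr_realpow) auto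
    then have "log 2 x \<le> real (Suc N)" using False by (simp add: log_le_iff)
    then obtain k where "(log 2 ^^ k) (log 2 x) \<le> 1" using Suc.IH[of "log 2 x"] by auto
    then have "(log 2 ^^ Suc k) x \<le> 1" by (simp add: funpow_swap1)
    then show ?thesis by blast
  qed
qed

lemma inv_tower_le_log_star: "r \<le> n \<Longrightarrow> inv_tower r \<le> log_star (real n)"
proof -
  assume "r \<le> n"
  have "(log 2 ^^ log_star (real n)) (real n) \<le> 1"
    unfolding log_star_def by (rule LeastI_ex) (rule ex_funpow_log_le_1[of _ n], simp)
  then have "n \<le> tower (log_star (real n))" using funpow_log_le_1 by fastforce
  then show ?thesis using \<open>r \<le> n\<close> by (simp add: inv_tower_le_iff)
qed

lemma log_star_pos: "2 \<le> n \<Longrightarrow> 1 \<le> log_star (real n)"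
proof -
  assume "2 \<le> n"
  have "(log 2 ^^ log_star (real n)) (real n) \<le> 1"
    unfolding log_star_def by (rule LeastI_ex) (rule ex_funpow_log_le_1[of _ n], simp)
  then show ?thesis using \<open>2 \<le> n\<close> by (cases "log_star (real n)") auto
qed

section \<open>Positions without the digit 2 among their lowest base-3 digits\<close>

text \<open>\<open>inv_tower\<close> is an integer iterated logarithm; \<open>sel l\<close> is the difference cover of level \<open>l\<close>.\<close>

definition sel :: "nat \<Rightarrow> nat \<Rightarrow> bool" where
  "sel l x \<longleftrightarrow> (\<forall>j<l. x div 3 ^ j mod 3 \<noteq> 2)"

lemma sel_0 [simp]: "sel 0 x"
  by (simp add: sel_def)

lemma sel_Suc: "sel (Suc l) x \<longleftrightarrow> sel l x \<and> x div 3 ^ l mod 3 \<noteq> 2"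
  by (auto simp: sel_def less_Suc_eq)

lemma sel_mono: "sel l x \<Longrightarrow> k \<le> l \<Longrightarrow> sel k x"
  by (auto simp: sel_def)

lemma sel_add [simp]: "sel l (x + m * 3 ^ l) \<longleftrightarrow> sel l x"
proof -
  have "(x + m * 3 ^ l) div 3 ^ j mod 3 = x div 3 ^ j mod 3" if "j < l" for j
  proof -
    obtain d where d: "l = j + Suc d" using \<open>j < l\<close> less_imp_add_positive
      by (metis add_Suc_right less_iff_Suc_add)
    have "x + m * 3 ^ l = x + (m * 3 ^ d * 3) * 3 ^ j" by (simp add: d power_add algebra_simps)
    then have "(x + m * 3 ^ l) div 3 ^ j = m * 3 ^ d * 3 + x div 3 ^ j"
      by (simp only: div_mult_self1 power_eq_0_iff, simp)
    then show ?thesis by simp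
  qed
  then show ?thesis by (simp add: sel_def)
qed

lemma sel_Suc_low: "sel (Suc l) x \<longleftrightarrow> x mod 3 \<noteq> 2 \<and> sel l (x div 3)"
proof -
  have "x div 3 ^ Suc j = x div 3 div 3 ^ j" for j
    by (simp add: div_mult2_eq)
  then show ?thesis unfolding sel_def
    by (auto simp: less_Suc_eq_0_disj)
qed

text \<open>Induction on the lowest digit: it is 0 or 1, and dropping it leaves a number selected
  one level below, so the count at most doubles.\<close>

lemma card_sel: "card {x. x < M * 3 ^ l \<and> sel l x} \<le> 2 ^ l * M"
proof (induction l)
  case 0
  then show ?case by simp
next
  case (Suc l)
  let ?A = "{x. x < M * 3 ^ l \<and> sel l x}"
  have fin: "finite ?A" by simp
  have "{x. x < M * 3 ^ Suc l \<and> sel (Suc l) x} \<subseteq> (\<lambda>y. 3 * y) ` ?A \<union> (\<lambda>y. 3 * y + 1) ` ?A"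
  proof
    fix x assume "x \<in> {x. x < M * 3 ^ Suc l \<and> sel (Suc l) x}"
    then have x: "x < M * 3 ^ Suc l" "x mod 3 \<noteq> 2" "sel l (x div 3)" by (auto simp: sel_Suc_low)
    then have "x div 3 \<in> ?A" by (auto simp: less_mult_imp_div_less mult_ac)
    moreover have "x = 3 * (x div 3) \<or> x = 3 * (x div 3) + 1" using x(2) by presburger
    ultimately show "x \<in> (\<lambda>y. 3 * y) ` ?A \<union> (\<lambda>y. 3 * y + 1) ` ?A" by blast
  qed
  then have "card {x. x < M * 3 ^ Suc l \<and> sel (Suc l) x} \<le> card ((\<lambda>y. 3 * y) ` ?A \<union> (\<lambda>y. 3 * y + 1) ` ?A)"
    using fin by (intro card_mono) auto
  also have "\<dots> \<le> card ?A + card ?A"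
    using fin card_Un_le[of "(\<lambda>y. 3 * y) ` ?A" "(\<lambda>y. 3 * y + 1) ` ?A"]
      card_image_le[OF fin, of "\<lambda>y. 3 * y"] card_image_le[OF fin, of "\<lambda>y. 3 * y + 1"] by linarith
  finally show ?case using Suc by simp
qed

section \<open>Levels, credits and their total\<close>

locale sizes =
  fixes n :: nat
  assumes n_pos: "1 \<le> n"
begin

text \<open>The block of length \<open>3 ^ l\<close> at position \<open>x\<close> is the element \<open>l * N + x\<close>.  Position \<open>n + 1\<close> is included, since a query
  may run off the string.  From level \<open>2 * thr\<close> on all ranks form a single group: there
  \<open>(2/3) ^ l * rmax\<close> is summable to a constant, as \<open>(4/9) ^ thr * 2 ^ thr \<le> 1\<close>.\<close>

definition N :: nat where "N = n + 2"
definition off :: nat where "off = N * N"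
definition rmax :: nat where "rmax = (LEAST r. n + 1 < 2 ^ Suc r)"
definition lmax :: nat where "lmax = (LEAST l. n < 3 ^ l)"
definition thr :: nat where "thr = (LEAST m. rmax \<le> 2 ^ m)"
definition gmax :: nat where "gmax = inv_tower rmax"

text \<open>The credit \<open>cr\<close> on low levels solves \<open>tp r + cr (r + 1) \<le> 2 * cr r\<close>: merging two roots of rank \<open>r\<close> leaves one of
  rank \<open>r + 1\<close> and a child that needs \<open>tp r\<close>.  A query spends time \<open>O(vc l)\<close> on level \<open>l\<close>, and merging
  two blocks pays for the comparisons of their three sub-blocks.\<close>

definition grp :: "nat \<Rightarrow> nat \<Rightarrow> nat" where
  "grp l r = (if l < 2 * thr then inv_tower r else 0)"
definition tp :: "nat \<Rightarrow> nat \<Rightarrow> nat" where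
  "tp l r = (if l < 2 * thr then tower (inv_tower r) else rmax)"
definition cr :: "nat \<Rightarrow> nat \<Rightarrow> nat" where
  "cr l r = (if l < 2 * thr then 2 ^ r * (gmax - inv_tower r) + tower (inv_tower r) else rmax)"
definition vc :: "nat \<Rightarrow> nat" where
  "vc l = (if l < 2 * thr then gmax else 0) + 2"
definition al :: "nat \<Rightarrow> nat" where
  "al l = vc l + 6 * vc (l - 1)"

definition cells :: "nat \<Rightarrow> nat set" where
  "cells l = {x. 1 \<le> x \<and> x \<le> n + 1 \<and> sel l x}"
definition V :: "nat set" where
  "V = (\<lambda>(l, x). l * N + x) ` (SIGMA l:{..lmax}. cells l)"
definition lev :: "nat \<Rightarrow> nat" where "lev u = u div N"

lemma N_pos [simp]: "0 < N" by (simp add: N_def)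

lemma lmax_less: "n < 3 ^ lmax"
proof -
  have "n < 3 ^ n" by (rule power_gt_expt) simp
  then show ?thesis unfolding lmax_def by (rule LeastI)
qed

lemma less_lmax: "3 ^ K \<le> n \<Longrightarrow> K < lmax"
  using lmax_less power_increasing[of lmax K "3::nat"] by (cases "lmax \<le> K") linarith+

lemma lmax_pos: "1 \<le> lmax"
  using less_lmax[of 0] n_pos by simp

lemma lmax_le: "3 ^ lmax \<le> 3 * n" "lmax \<le> n"
proof -
  have "\<not> n < 3 ^ (lmax - 1)"
    using not_less_Least[of "lmax - 1" "\<lambda>l. n < 3 ^ l"] lmax_pos unfolding lmax_def by simp
  then show "3 ^ lmax \<le> 3 * n" using lmax_pos by (cases lmax) auto
  have "n < 3 ^ n" by (rule power_gt_expt) simp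
  then show "lmax \<le> n" unfolding lmax_def by (rule Least_le)
qed

lemma rmax_less: "n + 1 < 2 ^ Suc rmax"
proof -
  have "n + 1 < 2 ^ Suc n" using less_exp[of "Suc n"] by simp
  then show ?thesis unfolding rmax_def by (rule LeastI)
qed

lemma le_rmax: "2 ^ r \<le> n + 1 \<Longrightarrow> r \<le> rmax"
  using rmax_less power_increasing[of "Suc rmax" r "2::nat"] by (cases "Suc rmax \<le> r") linarith+

lemma rmax_pos: "1 \<le> rmax"
  using le_rmax[of 1] n_pos by simp

lemma rmax_le: "2 ^ rmax \<le> n + 1"
proof -
  have "\<not> n + 1 < 2 ^ Suc (rmax - 1)"
    using not_less_Least[of "rmax - 1" "\<lambda>r. n + 1 < 2 ^ Suc r"] rmax_pos unfolding rmax_def by simp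
  then show ?thesis using rmax_pos by (cases rmax) auto
qed

lemma thr_le: "rmax \<le> 2 ^ thr" "1 \<le> thr \<Longrightarrow> 2 ^ thr \<le> 2 * rmax"
proof -
  have "rmax \<le> 2 ^ rmax" using less_exp[of rmax] by simp
  then show "rmax \<le> 2 ^ thr" unfolding thr_def by (rule LeastI)
  assume t: "1 \<le> thr"
  then have "\<not> rmax \<le> 2 ^ (thr - 1)"
    using not_less_Least[of "thr - 1" "\<lambda>m. rmax \<le> 2 ^ m"] unfolding thr_def by simp
  then show "2 ^ thr \<le> 2 * rmax" using t by (cases thr) auto
qed

lemma gmax_le_thr: "gmax \<le> thr"
  unfolding gmax_def inv_tower_le_iff using thr_le(1) pow_le_tower[of thr] by linarith

lemma rmax_le_n: "rmax \<le> n"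
  using rmax_le less_exp[of rmax] by linarith

lemma gmax_le_log_star: "gmax \<le> log_star (real n)"
  unfolding gmax_def using rmax_le_n by (rule inv_tower_le_log_star)

lemma grp_le: "r \<le> rmax \<Longrightarrow> grp l r + 2 \<le> vc l"
  unfolding grp_def vc_def gmax_def using inv_tower_mono by simp

lemma V_iff: "u \<in> V \<longleftrightarrow> (\<exists>l x. u = l * N + x \<and> l \<le> lmax \<and> x \<in> cells l)"
  unfolding V_def by auto

lemma lev_node [simp]: "x < N \<Longrightarrow> lev (l * N + x) = l"
  by (simp add: lev_def)

lemma cells_less: "x \<in> cells l \<Longrightarrow> x < N"
  by (simp add: cells_def N_def)

lemma finite_cells [simp]: "finite (cells l)"
  by (rule finite_subset[of _ "{..n+1}"]) (auto simp: cells_def)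

lemma node_less_off: "l \<le> lmax \<Longrightarrow> x < N \<Longrightarrow> l * N + x < off"
proof -
  assume "l \<le> lmax" "x < N"
  then have "l * N + x < (n + 1) * N" 
    using lmax_le(2) mult_le_mono1[of l n N] unfolding add_mult_distrib by linarith
  then show ?thesis unfolding off_def N_def by simp
qed

lemma union_find: "union_find V off rmax (n + 1) grp tp cr"
proof
  show "finite V" unfolding V_def by auto
  show "0 \<notin> V" by (auto simp: V_iff cells_def)
  show "u < off" if "u \<in> V" for u
    using that node_less_off cells_less by (auto simp: V_iff)
  show "grp l r \<le> grp l r'" if "r \<le> r'" for l r r'
    using that inv_tower_mono by (auto simp: grp_def)
  show "grp l r < grp l r'" if "tp l r < r'" "r' \<le> rmax" for l r r'
    using that inv_tower_less by (auto simp: grp_def tp_def split: if_splits)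
  show "tp l r \<le> cr l r" for l r by (auto simp: tp_def cr_def)
  show "r \<le> rmax" if "2 ^ r \<le> n + 1" for r using le_rmax that .
  show "tp l r + cr l (Suc r) \<le> 2 * cr l r" if "r < rmax" for l r
  proof (cases "l < 2 * thr")
    case True
    have g: "inv_tower (Suc r) \<le> gmax" unfolding gmax_def using that by (intro inv_tower_mono) simp
    consider "inv_tower (Suc r) = inv_tower r" 
      | "r = tower (inv_tower r)" "inv_tower (Suc r) = Suc (inv_tower r)"
      using inv_tower_Suc by blast
    then show ?thesis
    proof cases
      case 1
      then show ?thesis using True by (simp add: tp_def cr_def)
    next
      case 2
      \<comment> \<open>A group is left exactly at \<open>r = tower g\<close>, where the next tower
        equals \<open>2 ^ r\<close>. The factor \<open>gmax - inv_tower r\<close> drops by one there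
        and frees \<open>2 * 2 ^ r\<close>, which covers the jump of \<open>tower\<close>.\<close>
      define d where "d = gmax - Suc (inv_tower r)"
      have "gmax - inv_tower r = Suc d" using g 2 by (simp add: d_def)
      moreover have "tower (Suc (inv_tower r)) = 2 ^ r" using 2 by simp
      ultimately show ?thesis
        using True 2 unfolding tp_def cr_def by (simp add: algebra_simps d_def[symmetric] del: tower.simps)
    qed
  qed (simp add: tp_def cr_def)
qed

lemma card_cells: 
  assumes "l \<le> lmax" shows "real (card (cells l)) \<le> 5 * real n * (2 / 3) ^ l"
proof -
  define M where "M = (n + 1) div 3 ^ l + 1"
  have "x < M * 3 ^ l" if "x \<le> n + 1" for x
  proof -
    have "n + 1 < M * 3 ^ l" unfolding M_def 
      using dividend_less_div_times[of "3 ^ l" "n + 1"] by (simp add: algebra_simps)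
    then show ?thesis using that by linarith
  qed
  then have "card (cells l) \<le> card {x. x < M * 3 ^ l \<and> sel l x}"
    by (intro card_mono) (auto simp: cells_def)
  also have "\<dots> \<le> 2 ^ l * M" by (rule card_sel)
  finally have "card (cells l) * 3 ^ l \<le> 2 ^ l * (M * 3 ^ l)" by simp
  \<comment> \<open>The 5 comes from \<open>n + 1 + 3 ^ lmax \<le> 4 * n + 1\<close> and
    \<open>1 \<le> n\<close>; the whole last period is counted although it may overhang the
    string.\<close>
  also have "M * 3 ^ l \<le> 5 * n"
  proof -
    have "M * 3 ^ l \<le> n + 1 + 3 ^ l" unfolding M_def by (simp add: algebra_simps)
    moreover have "(3::nat) ^ l \<le> 3 ^ lmax" using assms by (intro power_increasing) auto
    ultimately show ?thesis using lmax_le(1) n_pos by linarith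
  qed
  finally have "real (card (cells l) * 3 ^ l) \<le> real (2 ^ l * (5 * n))" by (simp only: of_nat_le_iff) simp
  then show ?thesis by (simp add: power_divide field_simps)
qed

definition Phi0 :: nat where
  "Phi0 = (\<Sum>u\<in>V. cr (lev u) 0 + al (lev u))"

lemma Phi0_eq: "Phi0 = (\<Sum>l\<le>lmax. card (cells l) * (cr l 0 + al l))"
proof -
  have inj: "inj_on (\<lambda>(l, x). l * N + x) (SIGMA l:{..lmax}. cells l)"
  proof (rule inj_onI, clarsimp)
    fix l x l' x' assume *: "x \<in> cells l" "x' \<in> cells l'" "l * N + x = l' * N + x'"
    have "lev (l * N + x) = l" "lev (l' * N + x') = l'"
      using *(1,2) by (auto intro!: lev_node dest: cells_less)
    then show "l = l' \<and> x = x'" using * by auto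
  qed
  have "Phi0 = (\<Sum>(l, x)\<in>(SIGMA l:{..lmax}. cells l). cr l 0 + al l)"
    unfolding Phi0_def V_def sum.reindex[OF inj]
    by (rule sum.cong) (auto dest: cells_less)
  also have "\<dots> = (\<Sum>l\<le>lmax. \<Sum>x\<in>cells l. cr l 0 + al l)"
    by (subst sum.Sigma) auto
  finally show ?thesis by simp
qed

lemma geometric_tail: "(\<Sum>l\<in>{a..b}. (2/3::real) ^ l) \<le> 3 * (2/3) ^ a"
proof (induction "Suc b - a" arbitrary: a)
  case (Suc d)
  then have "a \<le> b" by simp
  then have "(\<Sum>l\<in>{a..b}. (2/3::real) ^ l) = (2/3) ^ a + (\<Sum>l\<in>{Suc a..b}. (2/3) ^ l)"
    by (simp add: sum.atLeast_Suc_atMost)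
  also have "\<dots> \<le> (2/3) ^ a + 3 * (2/3) ^ Suc a"
    using Suc by (intro add_left_mono Suc.hyps(1)) simp
  finally show ?case by simp
qed simp

text \<open>The constants are \<open>120 = 5 * 3 * 8\<close> and
  \<open>240 = 5 * (3 * 15 + 3)\<close>: the 5 is from \<open>card_cells\<close>, the factor 3 is
  the geometric series, \<open>8 * gmax + 15\<close> bounds \<open>al\<close> plus the part of
  \<open>cr\<close> at rank 0 present on all levels, and the last 3 bounds the extra
  \<open>rmax\<close> per element from level \<open>2 * thr\<close> on.\<close>

lemma Phi0_bound: "real Phi0 \<le> real n * (120 * real gmax + 240)"
proof -
  let ?h = "\<lambda>l. if l < 2 * thr then 0 else real rmax * (2/3) ^ l"
  have c: "real (cr l 0 + al l) \<le> (8 * real gmax + 15) + (if l < 2 * thr then 0 else real rmax)" for l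
  proof -
    have "al l \<le> 7 * (gmax + 2)" by (auto simp: al_def vc_def)
    moreover have "inv_tower 0 = 0" using inv_tower_le_iff[of 0 0] by simp
    then have "cr l 0 \<le> gmax + 1 + (if l < 2 * thr then 0 else rmax)"
      by (auto simp: cr_def)
    ultimately have "cr l 0 + al l \<le> (8 * gmax + 15) + (if l < 2 * thr then 0 else rmax)" by simp
    then have "real (cr l 0 + al l) \<le> real ((8 * gmax + 15) + (if l < 2 * thr then 0 else rmax))"
      using of_nat_le_iff by blast
    then show ?thesis by (auto split: if_splits)
  qed
  have "real Phi0 = (\<Sum>l\<le>lmax. real (card (cells l)) * real (cr l 0 + al l))"
    unfolding Phi0_eq by simp
  also have "\<dots> \<le> (\<Sum>l\<le>lmax. 5 * real n * ((8 * real gmax + 15) * (2/3) ^ l + ?h l))"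
  proof (rule sum_mono)
    fix l assume "l \<in> {..lmax}"
    then have "real (card (cells l)) * real (cr l 0 + al l) \<le> 
       (5 * real n * (2 / 3) ^ l) * ((8 * real gmax + 15) + (if l < 2 * thr then 0 else real rmax))"
      using card_cells c by (intro mult_mono) auto
    then show "real (card (cells l)) * real (cr l 0 + al l) \<le> 5 * real n * ((8 * real gmax + 15) * (2/3) ^ l + ?h l)"
      by (auto simp: algebra_simps)
  qed
  also have "\<dots> = 5 * real n * ((8 * real gmax + 15) * (\<Sum>l\<le>lmax. (2/3) ^ l) + (\<Sum>l\<le>lmax. ?h l))"
    by (subst sum_distrib_left[symmetric], subst sum.distrib, subst sum_distrib_left[symmetric]) (rule refl)
  also have "\<dots> \<le> 5 * real n * ((8 * real gmax + 15) * 3 + 3)"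
  proof (intro mult_left_mono add_mono)
    show "(\<Sum>l\<le>lmax. (2/3::real) ^ l) \<le> 3"
      using geometric_tail[of 0 lmax] by (simp add: atLeast0AtMost)
    have "(\<Sum>l\<le>lmax. ?h l) = (\<Sum>l\<in>{2 * thr..lmax}. real rmax * (2/3) ^ l)"
      by (rule sum.mono_neutral_cong_right) auto
    also have "\<dots> \<le> real rmax * (3 * (2/3) ^ (2 * thr))"
      unfolding sum_distrib_left[symmetric] using geometric_tail by (intro mult_left_mono) auto
    also have "\<dots> \<le> 2 ^ thr * (3 * (2/3) ^ (2 * thr))"
    proof (rule mult_right_mono)
      have "real rmax \<le> real (2 ^ thr)" unfolding of_nat_le_iff by (rule thr_le)
      then show "real rmax \<le> 2 ^ thr" by simp
    qed simp
    also have "\<dots> = 3 * (8/9) ^ thr" by (simp add: power_mult power_divide power_mult_distrib[symmetric])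
    also have "\<dots> \<le> 3" by (simp add: power_le_one)
    finally show "(\<Sum>l\<le>lmax. ?h l) \<le> 3" .
  qed auto
  also have "\<dots> = real n * (120 * real gmax + 240)" by (simp add: algebra_simps)
  finally show ?thesis .
qed

text \<open>Only about \<open>log log n\<close> levels carry the factor \<open>gmax\<close>, so
  their share is small:
  \<open>thr * gmax \<le> thr * thr \<le> 2 * 2 ^ thr \<le> 4 * rmax\<close>.\<close>

lemma sum_vc_bound:
  assumes "2 \<le> n" shows "real (\<Sum>l\<le>lmax. vc l) \<le> 24 * log 2 (real n)"
proof -
  have sq: "m * m \<le> 2 * 2 ^ m" for m :: nat
  proof (induction m)
    case (Suc m)
    have "m < 2 ^ m" by (rule less_exp)
    then have "2 * m + 1 \<le> 2 * 2 ^ m" by linarith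
    then show ?case using Suc by simp
  qed simp
  have tg: "thr * gmax \<le> 4 * rmax"
  proof (cases "thr = 0")
    case False
    have "thr * gmax \<le> thr * thr" using gmax_le_thr by simp
    also have "\<dots> \<le> 2 * 2 ^ thr" by (rule sq)
    also have "\<dots> \<le> 4 * rmax" using thr_le(2) False by simp
    finally show ?thesis .
  qed simp
  have "(\<Sum>l\<le>lmax. vc l) = (\<Sum>l\<le>lmax. if l < 2 * thr then gmax else 0) + 2 * (lmax + 1)"
    unfolding vc_def sum.distrib by simp
  also have "(\<Sum>l\<le>lmax. if l < 2 * thr then gmax else 0) = card ({..lmax} \<inter> {l. l < 2 * thr}) * gmax"
    by (simp add: sum.If_cases)
  also have "\<dots> \<le> card {..<2 * thr} * gmax"
    by (intro mult_right_mono card_mono) auto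
  also have "\<dots> \<le> 8 * rmax" using tg by (simp add: mult.commute)
  finally have 1: "(\<Sum>l\<le>lmax. vc l) \<le> 8 * rmax + 2 * (lmax + 1)" by simp
  have pw: "a \<le> log 2 (real b)" if "2 ^ a \<le> b" "b > 0" for a b :: nat
    using that by (metis le_log2_of_power)
  have "real rmax \<le> log 2 (real (2 * n))"
    using rmax_le n_pos by (intro pw) auto
  then have r: "real rmax \<le> log 2 (real n) + 1" using n_pos by (simp add: log_mult)
  have "(2::nat) ^ lmax \<le> 3 ^ lmax" by (intro power_mono) auto
  then have "real lmax \<le> log 2 (real (4 * n))"
    using lmax_le(1) n_pos by (intro pw) auto
  also have "\<dots> = log 2 4 + log 2 (real n)" using n_pos by (simp add: log_mult)
  also have "log 2 (4::real) = 2" using log_pow_cancel[of 2 2] by simp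
  finally have l: "real lmax \<le> 2 + log 2 (real n)" .
  \<comment> \<open>With \<open>L = log 2 n\<close>, the total is at most
    \<open>8 * (L + 1) + 2 * (L + 3) = 10 * L + 14\<close>, hence at most \<open>24 * L\<close> as
    \<open>1 \<le> L\<close>.\<close>
  have "1 \<le> log 2 (real n)" using assms by simp
  moreover have "real (\<Sum>l\<le>lmax. vc l) \<le> real (8 * rmax + 2 * (lmax + 1))" 
    using 1 of_nat_le_iff by blast
  ultimately show ?thesis using r l by simp
qed

end

section \<open>A weakest-precondition calculus that records time and symbol tests\<close>

definition wp :: "nat \<Rightarrow> (nat \<Rightarrow> nat \<Rightarrow> bool) \<Rightarrow> com \<Rightarrow> state \<Rightarrow> (nat \<Rightarrow> nat \<Rightarrow> state \<Rightarrow> bool) \<Rightarrow> bool" where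
  "wp W eq c s Q \<longleftrightarrow> (\<exists>t e s'. exec W eq c s t e s' \<and> Q t e s')"

lemma reg_set_reg [simp]: "reg (set_reg x v s) = (reg s)(x := v)"
  and mem_set_reg [simp]: "mem (set_reg x v s) = mem s"
  and reg_set_mem [simp]: "reg (set_mem x v s) = reg s"
  and mem_set_mem [simp]: "mem (set_mem x v s) = (mem s)(x := v)"
  by (simp_all add: set_reg_def set_mem_def)

lemma wp_basic [simp]:
  "wp W eq Skip s Q \<longleftrightarrow> Q 1 0 s"
  "wp W eq (Const x k) s Q \<longleftrightarrow> Q 1 0 (set_reg x (k mod 2 ^ W) s)"
  "wp W eq (Copy x y) s Q \<longleftrightarrow> Q 1 0 (set_reg x (reg s y) s)"
  "wp W eq (Binop x f y z) s Q \<longleftrightarrow> Q 1 0 (set_reg x (binop_val W f (reg s y) (reg s z)) s)"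
  "wp W eq (Load x y) s Q \<longleftrightarrow> Q 1 0 (set_reg x (mem s (reg s y)) s)"
  "wp W eq (Store x y) s Q \<longleftrightarrow> Q 1 0 (set_mem (reg s x) (reg s y) s)"
  "wp W eq (SymEq x y z) s Q \<longleftrightarrow> Q 1 1 (set_reg x (of_bool (eq (reg s y) (reg s z)) mod 2 ^ W) s)"
  unfolding wp_def by (safe, (blast intro: exec.intros | (erule exec.cases, simp_all; fail))+)

lemma wp_Seq [simp]:
  "wp W eq (Seq c1 c2) s Q \<longleftrightarrow>
     wp W eq c1 s (\<lambda>t1 e1 s1. wp W eq c2 s1 (\<lambda>t2 e2 s2. Q (t1 + t2) (e1 + e2) s2))"
proof
  assume "wp W eq (Seq c1 c2) s Q"
  then obtain t e s' where *: "exec W eq (Seq c1 c2) s t e s'" "Q t e s'" by (auto simp: wp_def)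
  from *(1) show "wp W eq c1 s (\<lambda>t1 e1 s1. wp W eq c2 s1 (\<lambda>t2 e2 s2. Q (t1 + t2) (e1 + e2) s2))"
    by cases (use *(2) in \<open>unfold wp_def, blast\<close>)
qed (unfold wp_def, blast intro: exec.intros)

lemma wp_Cond [simp]:
  "wp W eq (Cond x c1 c2) s Q \<longleftrightarrow>
     (if reg s x \<noteq> 0 then wp W eq c1 s (\<lambda>t e s'. Q (t + 1) e s') else wp W eq c2 s (\<lambda>t e s'. Q (t + 1) e s'))"
  (is "?L \<longleftrightarrow> ?R")
proof
  assume ?L
  then obtain t e s' where *: "exec W eq (Cond x c1 c2) s t e s'" "Q t e s'" by (auto simp: wp_def)
  from *(1) show ?R by cases (use *(2) in \<open>simp_all add: wp_def, blast+\<close>)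
next
  assume ?R
  show ?L
  proof (cases "reg s x = 0")
    case True
    with \<open>?R\<close> have "wp W eq c2 s (\<lambda>t e s'. Q (t + 1) e s')" by simp
    then show ?thesis using True unfolding wp_def by (blast intro: exec.CondFalse)
  next
    case False
    with \<open>?R\<close> have "wp W eq c1 s (\<lambda>t e s'. Q (t + 1) e s')" by simp
    then show ?thesis using False unfolding wp_def by (blast intro: exec.CondTrue)
  qed
qed

lemma wp_mono: "wp W eq c s Q \<Longrightarrow> (\<And>t e s'. Q t e s' \<Longrightarrow> Q' t e s') \<Longrightarrow> wp W eq c s Q'"
  unfolding wp_def by blast

text \<open>A bound on the elapsed time doubles as the termination measure.\<close>

lemma wp_While:
  assumes init: "I 0 0 s"
    and bound: "\<And>t e s. I t e s \<Longrightarrow> t \<le> B"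
    and step: "\<And>t e s. I t e s \<Longrightarrow> reg s x \<noteq> 0 \<Longrightarrow> wp W eq c s (\<lambda>t' e' s'. I (t + t' + 1) (e + e') s')"
    and fin: "\<And>t e s. I t e s \<Longrightarrow> reg s x = 0 \<Longrightarrow> Q (t + 1) e s"
  shows "wp W eq (While x c) s Q"
proof -
  have "\<exists>t' e' s'. exec W eq (While x c) s t' e' s' \<and> Q (t + t') (e + e') s'" if "I t e s" for t e s
    using that
  proof (induction "B - t" arbitrary: t e s rule: less_induct)
    case less
    show ?case
    proof (cases "reg s x = 0")
      case True
      then show ?thesis using fin[OF less.prems] exec.WhileFalse[of s x W eq c] by fastforce
    next
      case False
      from step[OF less.prems this] obtain t1 e1 s1
        where 1: "exec W eq c s t1 e1 s1" "I (t + t1 + 1) (e + e1) s1" by (auto simp: wp_def)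
      have "B - (t + t1 + 1) < B - t" using bound[OF 1(2)] by simp
      from less.hyps[OF this 1(2)] obtain t2 e2 s2
        where 2: "exec W eq (While x c) s1 t2 e2 s2" "Q (t + t1 + 1 + t2) (e + e1 + e2) s2" by blast
      have "exec W eq (While x c) s (t1 + t2 + 1) (e1 + e2) s2"
        using False 1(1) 2(1) by (rule exec.WhileTrue)
      moreover have "Q (t + (t1 + t2 + 1)) (e + (e1 + e2)) s2" using 2(2) by (simp add: ac_simps)
      ultimately show ?thesis by blast
    qed
  qed
  from this[OF init] show ?thesis by (auto simp: wp_def)
qed

section \<open>The union-find programs and their amortised cost\<close>

text \<open>Registers: 0 answer, 1 and 2 query, 3 to 8 the constants \<open>N\<close>, \<open>off\<close>, 1, 2, 3, \<open>n + 1\<close>, 10 and 11 starting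
  positions \<open>A\<close>, \<open>B\<close> of the top blocks, 12 offset, 13 \<open>3 ^ k\<close>, 14 \<open>k * N\<close>, 15 mode, 16 loop flag,
  17 \<open>3 ^ K\<close>, from 20 on temporaries (20 and 21: the two roots).\<close>

definition link_roots :: com where
  "link_roots =
    Seq (Binop 22 Add 20 4) (Seq (Load 22 22) (Seq (Binop 23 Add 21 4) (Seq (Load 23 23)
    (Seq (Binop 24 Less 22 23) (Cond 24 (Store 20 21)
      (Seq (Store 21 20) (Seq (Binop 24 Equal 22 23) (Cond 24
        (Seq (Binop 23 Add 20 4) (Seq (Binop 22 Add 22 5) (Store 23 22))) Skip))))))))"

text \<open>Halving works in a single upward pass, so neither a stack nor a second walk is needed.
  At each loop test \<open>y\<close> holds the parent of \<open>x\<close>.\<close>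

definition find_root :: "nat \<Rightarrow> nat \<Rightarrow> nat \<Rightarrow> com" where
  "find_root x y z = Seq (Load y x) (While y (Seq (Load z y) (Cond z
     (Seq (Store x z) (Seq (Copy x z) (Load y x)))
     (Seq (Copy x y) (Const y 0)))))"

context union_find
begin

lemma wp_find_root:
  assumes f: "forest (mem s) \<rho>" and u: "u = reg s x" "u \<in> V"
    and d: "x \<noteq> y" "x \<noteq> z" "y \<noteq> z"
  shows "wp W eq (find_root x y z) s (\<lambda>t e s'. e = 0 \<and> forest (mem s') \<rho> \<and> reg s' x = \<rho> u \<and>
     (\<forall>r. r \<noteq> x \<and> r \<noteq> y \<and> r \<noteq> z \<longrightarrow> reg s' r = reg s r) \<and> (\<forall>l. roots (mem s') l = roots (mem s) l) \<and>
     Phi (mem s') \<le> Phi (mem s) \<and>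
     t + 10 * Phi (mem s') \<le> 10 * Phi (mem s) + 10 * grp (lev u) R + 12)"
proof -
  \<comment> \<open>The additional 10 at the end pays for the move from a child of the root to the
    root, which halves nothing. All other moves are paid by \<open>halve_step\<close>, whose group
    numbers telescope along the path.\<close>
  define I where "I t e s' \<longleftrightarrow> e = 0 \<and> forest (mem s') \<rho> \<and> reg s' x \<in> V \<and> \<rho> (reg s' x) = \<rho> u \<and>
     lev (reg s' x) = lev u \<and> reg s' y = mem s' (reg s' x) \<and>
     (\<forall>r. r \<noteq> x \<and> r \<noteq> y \<and> r \<noteq> z \<longrightarrow> reg s' r = reg s r) \<and> (\<forall>l. roots (mem s') l = roots (mem s) l) \<and>
     Phi (mem s') \<le> Phi (mem s) \<and>
     t + 10 * Phi (mem s') \<le> 10 * Phi (mem s) + 10 * grp (lev u) (mem s' (reg s' x + off)) + 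
        (if reg s' y = 0 then 10 else 0)" for t e :: nat and s' :: state
  have gR: "grp l r \<le> grp l R" if "r \<le> R" for l r using grp_mono that by blast
  have "wp W eq (While y (Seq (Load z y) (Cond z
     (Seq (Store x z) (Seq (Copy x z) (Load y x)))
     (Seq (Copy x y) (Const y 0))))) (set_reg y (mem s u) s) (\<lambda>t e s'. e = 0 \<and> forest (mem s') \<rho> \<and> reg s' x = \<rho> u \<and>
     (\<forall>r. r \<noteq> x \<and> r \<noteq> y \<and> r \<noteq> z \<longrightarrow> reg s' r = reg s r) \<and> (\<forall>l. roots (mem s') l = roots (mem s) l) \<and>
     Phi (mem s') \<le> Phi (mem s) \<and>
     t + 10 * Phi (mem s') \<le> 10 * Phi (mem s) + 10 * grp (lev u) R + 11)"
  proof (rule wp_While[where I = I and B = "10 * Phi (mem s) + 10 * grp (lev u) R + 10"])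
    show "I 0 0 (set_reg y (mem s u) s)"
      using f u d by (auto simp: I_def)
    show "t \<le> 10 * Phi (mem s) + 10 * grp (lev u) R + 10" if "I t e s'" for t e s'
      using that gR[OF forestD(4), of "mem s'" \<rho> "reg s' x" "lev u"] by (auto simp: I_def split: if_splits)
    fix t e s' assume I: "I t e s'"
    let ?x = "reg s' x"
    have f': "forest (mem s') \<rho>" and x: "?x \<in> V" using I by (auto simp: I_def)
    note fx = forestD[OF f' x]
    {
      assume "reg s' y = 0"
      then have "\<rho> u = ?x" "mem s' ?x = 0" using I fx by (auto simp: I_def)
      then show "e = 0 \<and> forest (mem s') \<rho> \<and> reg s' x = \<rho> u \<and>
       (\<forall>r. r \<noteq> x \<and> r \<noteq> y \<and> r \<noteq> z \<longrightarrow> reg s' r = reg s r) \<and> (\<forall>l. roots (mem s') l = roots (mem s) l) \<and>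
       Phi (mem s') \<le> Phi (mem s) \<and>
       t + 1 + 10 * Phi (mem s') \<le> 10 * Phi (mem s) + 10 * grp (lev u) R + 11"
        using I gR[OF fx(4), of "lev u"] by (auto simp: I_def)
    }
    assume y0: "reg s' y \<noteq> 0"
    let ?y = "mem s' ?x" let ?z = "mem s' ?y"
    have y: "reg s' y = ?y" "?y \<noteq> 0" using I y0 by (auto simp: I_def)
    note fy = forestD[OF f' fx(6)[OF y(2)]]
    show "wp W eq (Seq (Load z y) (Cond z
     (Seq (Store x z) (Seq (Copy x z) (Load y x)))
     (Seq (Copy x y) (Const y 0)))) s' (\<lambda>t' e' s'. I (t + t' + 1) (e + e') s')"
    proof (cases "?z = 0")
      case True
      have "grp (lev u) (mem s' (?x + off)) \<le> grp (lev u) (mem s' (?y + off))"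
        using fx(9) y fy(4) by (intro grp_mono) auto
      then show ?thesis using True I y d fx fy by (auto simp: I_def)
    next
      case False
      have "?z \<in> V" "lev ?z = lev u" "\<rho> ?z = \<rho> u" using fx fy y False I by (auto simp: I_def)
      moreover note h = halve_step[OF f' x y(2) False]
      moreover have "?z + off \<noteq> ?x" using V_neq_off x by auto
      moreover have "?z \<noteq> ?x" using fx(9) fy(9) y False by auto
      ultimately show ?thesis using False I y d by (auto simp: I_def)
    qed
  qed
  then show ?thesis unfolding find_root_def using u
    by simp (erule wp_mono, auto)
qed

lemma wp_link_roots:
  assumes f: "forest (mem s) \<rho>" and u: "reg s 20 \<in> V" "mem s (reg s 20) = 0" and v: "reg s 21 \<in> V" "mem s (reg s 21) = 0"
    and uv: "reg s 20 \<noteq> reg s 21" "lev (reg s 20) = lev (reg s 21)"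
    and W: "2 * off \<le> 2 ^ W" "R < off" and c: "reg s 4 = off" "reg s 5 = 1"
  shows "wp W eq link_roots s (\<lambda>t e s'. e = 0 \<and> t \<le> 12 \<and>
     (\<forall>r. r \<notin> {22, 23, 24} \<longrightarrow> reg s' r = reg s r) \<and>
     (\<exists>\<rho>' u v. (u = reg s 20 \<and> v = reg s 21 \<or> u = reg s 21 \<and> v = reg s 20) \<and>
       \<rho>' = (\<lambda>x. if \<rho> x = u then v else \<rho> x) \<and> forest (mem s') \<rho>' \<and> 
       (\<forall>l. roots (mem s') l = roots (mem s) l - {u}) \<and> Phi (mem s') + al (lev (reg s 20)) \<le> Phi (mem s)))"
proof -
  let ?u = "reg s 20" and ?v = "reg s 21" and ?m = "mem s"
  have o: "?u + off < 2 ^ W" "?v + off < 2 ^ W" using V_less u(1) v(1) W by fastforce+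
  have rk: "?m (?u + off) < off" "?m (?v + off) < off" using forestD(4)[OF f] u v W by fastforce+
  have W2: "Suc 0 < 2 ^ W" "Suc (?m (?u + off)) < 2 ^ W" using W rk by linarith+
  note ne = V_neq_off[OF u(1)] V_neq_off[OF v(1)]
  have ex: "wp W eq link_roots s (\<lambda>t e s'. e = 0 \<and> t \<le> 12 \<and>
     (\<forall>r. r \<notin> {22, 23, 24} \<longrightarrow> reg s' r = reg s r) \<and>
     mem s' = (if ?m (?u + off) < ?m (?v + off) then ?m(?u := ?v)
       else if ?m (?u + off) = ?m (?v + off) then ?m(?v := ?u, ?u + off := Suc (?m (?u + off))) else ?m(?v := ?u)))"
    using o W2 ne unfolding c[symmetric] by (simp add: link_roots_def c(2))
  have less: "?m(?u := ?v) = ?m(?u := ?v, ?v + off := ?m (?v + off))" using ne by auto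
  have greater: "?m(?v := ?u) = ?m(?v := ?u, ?u + off := ?m (?u + off))" using ne by auto
  have l1: "forest (?m(?u := ?v)) (\<lambda>x. if \<rho> x = ?u then ?v else \<rho> x)" 
    "roots (?m(?u := ?v)) l = roots ?m l - {?u}" "Phi (?m(?u := ?v)) + al (lev ?u) \<le> Phi ?m"
    if "?m (?u + off) < ?m (?v + off)" for l
    by (rule link[OF f u v uv _ less refl], use that in simp)+
  have l2: "forest (?m(?v := ?u, ?u + off := Suc (?m (?u + off)))) (\<lambda>x. if \<rho> x = ?v then ?u else \<rho> x)" 
    "roots (?m(?v := ?u, ?u + off := Suc (?m (?u + off)))) l = roots ?m l - {?v}" 
    "Phi (?m(?v := ?u, ?u + off := Suc (?m (?u + off)))) + al (lev ?u) \<le> Phi ?m"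
    if "?m (?u + off) = ?m (?v + off)" for l
    by (rule link[OF f v u uv(1)[symmetric] uv(2)[symmetric] _ refl refl, unfolded uv(2)[symmetric]], use that in simp)+
  have l3: "forest (?m(?v := ?u)) (\<lambda>x. if \<rho> x = ?v then ?u else \<rho> x)" 
    "roots (?m(?v := ?u)) l = roots ?m l - {?v}" "Phi (?m(?v := ?u)) + al (lev ?u) \<le> Phi ?m"
    if "?m (?v + off) < ?m (?u + off)" for l
    by (rule link[OF f v u uv(1)[symmetric] uv(2)[symmetric] _ greater refl, unfolded uv(2)[symmetric]], use that in simp)+
  consider "?m (?u + off) < ?m (?v + off)" | "?m (?u + off) = ?m (?v + off)" | "?m (?v + off) < ?m (?u + off)"
    by linarith
  then show ?thesis
  proof cases
    case 1
    show ?thesis 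
      by (rule wp_mono[OF ex], rule conjI, blast, rule conjI, blast, rule conjI, blast,
          rule exI[of _ "\<lambda>x. if \<rho> x = ?u then ?v else \<rho> x"], rule exI[of _ ?u], rule exI[of _ ?v])
        (use 1 l1 in simp)
  next
    case 2
    show ?thesis 
      by (rule wp_mono[OF ex], rule conjI, blast, rule conjI, blast, rule conjI, blast,
          rule exI[of _ "\<lambda>x. if \<rho> x = ?v then ?u else \<rho> x"], rule exI[of _ ?v], rule exI[of _ ?u])
        (use 2 l2 in simp)
  next
    case 3
    show ?thesis 
      by (rule wp_mono[OF ex], rule conjI, blast, rule conjI, blast, rule conjI, blast,
          rule exI[of _ "\<lambda>x. if \<rho> x = ?v then ?u else \<rho> x"], rule exI[of _ ?v], rule exI[of _ ?u])
        (use 3 l3 in simp)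
  qed
qed

end

section \<open>Moving between neighbouring and enclosing blocks in base 3\<close>

lemma div_pow_add_next:
  assumes "3 ^ k dvd (x::nat)" "x div 3 ^ k mod 3 \<noteq> 2" "k < l"
  shows "(x + 3 ^ k) div 3 ^ l = x div 3 ^ l"
proof -
  obtain y where y: "x = 3 ^ k * y" using assms(1) by (auto simp: dvd_def)
  obtain d where d: "l = k + Suc d" using assms(3) by (metis add_Suc_right less_iff_Suc_add)
  have "y mod 3 \<noteq> 2" using assms(2) y by simp
  then have "Suc y div 3 = y div 3" by presburger
  moreover have "z * 3 ^ k div 3 ^ l = z div 3 div 3 ^ d" for z :: nat
    by (simp add: d power_add mult.assoc[symmetric] div_mult2_eq[symmetric] mult.commute[of _ "3 ^ k"])
  moreover have "x + 3 ^ k = Suc y * 3 ^ k" "x = y * 3 ^ k" using y by auto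
  ultimately show ?thesis by metis
qed

text \<open>Digit \<open>k\<close> of the offset tells which third of its enclosing block is being
  compared, so the offset itself replaces a recursion stack. Digit 2 marks the last third; clearing
  it gives the enclosing block, and the higher digits, which locate the outer blocks, do not
  change.\<close>

lemma div_pow_sub_up:
  assumes "3 ^ k dvd (x::nat)" "x div 3 ^ k mod 3 = 2"
  shows "2 * 3 ^ k \<le> x" "3 ^ Suc k dvd x - 2 * 3 ^ k" "k < l \<Longrightarrow> (x - 2 * 3 ^ k) div 3 ^ l = x div 3 ^ l"
proof -
  obtain y where y: "x = 3 ^ k * y" using assms(1) by (auto simp: dvd_def)
  have "y mod 3 = 2" using assms(2) y by simp
  then obtain z where z: "y = 3 * z + 2" by (metis mult_div_mod_eq)
  show "2 * 3 ^ k \<le> x" using y z by simp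
  have sub: "x - 2 * 3 ^ k = 3 ^ Suc k * z" using y z by (simp add: algebra_simps)
  then show "3 ^ Suc k dvd x - 2 * 3 ^ k" by simp
  assume "k < l"
  then obtain d where d: "l = k + Suc d" by (metis add_Suc_right less_iff_Suc_add)
  have e: "w * 3 ^ k div 3 ^ l = w div 3 div 3 ^ d" for w :: nat
    by (simp add: d power_add mult.assoc[symmetric] div_mult2_eq[symmetric] mult.commute[of _ "3 ^ k"])
  have "x - 2 * 3 ^ k = (3 * z) * 3 ^ k" "x = y * 3 ^ k" using y sub by auto
  moreover have "(3 * z + 2) div 3 = z" by presburger
  ultimately show "(x - 2 * 3 ^ k) div 3 ^ l = x div 3 ^ l" using e[of "3 * z"] e[of y] z by simp
qed

text \<open>Among any three successive blocks there is one whose two starting positions are both selected on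
  the next level, so a query climbs after at most three blocks.\<close>

definition climb_dist :: "nat \<Rightarrow> nat \<Rightarrow> nat" where
  "climb_dist a b =
     (if (a + 1) mod 3 \<noteq> 2 \<and> (b + 1) mod 3 \<noteq> 2 then 1
      else if (a + 2) mod 3 \<noteq> 2 \<and> (b + 2) mod 3 \<noteq> 2 then 2 else 3)"

lemma climb_dist_range: "1 \<le> climb_dist a b" "climb_dist a b \<le> 3"
  by (auto simp: climb_dist_def)

text \<open>Each of \<open>a\<close> and \<open>b\<close> excludes one residue of the shift modulo
  3, so a shift of 3 is available whenever 1 and 2 are not. Both sides depend on residues only,
  which leaves nine cases.\<close>

lemma climb_dist_Suc:
  assumes "(a + 1) mod 3 = 2 \<or> (b + 1) mod 3 = 2"
  shows "climb_dist a b = Suc (climb_dist (a + 1) (b + 1))"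
proof -
  have *: "climb_dist a b = climb_dist (a mod 3) (b mod 3)" for a b
    by (simp add: climb_dist_def mod_simps)
  have "a mod 3 = 0 \<or> a mod 3 = 1 \<or> a mod 3 = 2" "b mod 3 = 0 \<or> b mod 3 = 1 \<or> b mod 3 = 2" by auto
  then show ?thesis
    using assms unfolding *[of a b] *[of "a + 1" "b + 1"] mod_add_left_eq[of a 3 1, symmetric] mod_add_left_eq[of b 3 1, symmetric]
    by (elim disjE) (simp_all add: climb_dist_def)
qed

section \<open>The invariant of a query and the account of its comparisons\<close>

locale lce = sizes +
  fixes eq :: "nat \<Rightarrow> nat \<Rightarrow> bool" and W :: nat
  assumes eq_sym: "eq p q \<Longrightarrow> eq q p"
    and eq_trans: "eq p q \<Longrightarrow> eq q r \<Longrightarrow> eq p r"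
    and eq_range: "eq p q \<Longrightarrow> 1 \<le> p \<and> p \<le> n"
    and word: "4 * (N * N) \<le> 2 ^ W"

sublocale lce \<subseteq> uf: union_find V lev off rmax "n + 1" grp tp cr al
  by (rule union_find)

context lce
begin

definition meq :: "nat \<Rightarrow> nat \<Rightarrow> nat \<Rightarrow> bool" where
  "meq p q m \<longleftrightarrow> (\<forall>t<m. eq (p + t) (q + t))"

text \<open>The alternative \<open>\<rho> u = u\<close> is there because \<open>eq\<close> fails off
  the string: a block that overhangs the end does not satisfy \<open>meq\<close> even with
  itself.\<close>

definition sound :: "(nat \<Rightarrow> nat) \<Rightarrow> bool" where
  "sound \<rho> \<longleftrightarrow> (\<forall>u\<in>V. \<rho> u = u \<or> meq (u mod N) (\<rho> u mod N) (3 ^ lev u))"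

lemma meq_sym: "meq p q m \<Longrightarrow> meq q p m"
  using eq_sym by (auto simp: meq_def)

lemma meq_trans: "meq p q m \<Longrightarrow> meq q r m \<Longrightarrow> meq p r m"
  using eq_trans by (auto simp: meq_def)

lemma meq_0 [simp]: "meq p q 0"
  by (simp add: meq_def)

lemma meq_add: "meq p q m \<Longrightarrow> meq (p + m) (q + m) m' \<Longrightarrow> meq p q (m + m')"
proof -
  assume *: "meq p q m" "meq (p + m) (q + m) m'"
  show ?thesis unfolding meq_def
  proof (intro allI impI)
    fix t assume "t < m + m'"
    then show "eq (p + t) (q + t)"
      using * by (cases "t < m") (auto simp: meq_def dest!: spec[of _ "t - m"])
  qed
qed

lemma meq_shift: "meq p q m \<Longrightarrow> a + m' \<le> m \<Longrightarrow> meq (p + a) (q + a) m'"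
  by (auto simp: meq_def add.assoc)

text \<open>The last matching pair already lies inside the string. This keeps every position that a
  query reaches at most \<open>n + 1\<close>, hence within \<open>cells\<close>.\<close>

lemma meq_range:
  assumes "meq p q m" "p \<le> n" "q \<le> n" shows "p + m \<le> n + 1" "q + m \<le> n + 1"
proof -
  have "p + m \<le> n + 1 \<and> q + m \<le> n + 1"
  proof (cases m)
    case (Suc k)
    then have "eq (p + k) (q + k)" using assms by (auto simp: meq_def)
    then show ?thesis using eq_range[of "p + k" "q + k"] eq_range[of "q + k" "p + k"] eq_sym Suc by auto
  qed (use assms in auto)
  then show "p + m \<le> n + 1" "q + m \<le> n + 1" by auto
qed

lemma node_in_V: "l \<le> lmax \<Longrightarrow> x \<in> cells l \<Longrightarrow> l * N + x \<in> V"
  by (auto simp: V_iff)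

lemma sound_eq:
  assumes s: "sound \<rho>" and l: "l \<le> lmax" and x: "x \<in> cells l" "y \<in> cells l"
    and eq: "\<rho> (l * N + x) = \<rho> (l * N + y)" and ne: "x \<noteq> y"
  shows "meq x y (3 ^ l)"
proof -
  let ?u = "l * N + x" and ?v = "l * N + y"
  have u: "?u \<in> V" "?v \<in> V" using node_in_V l x by auto
  have lev: "lev ?u = l" "lev ?v = l" "?u mod N = x" "?v mod N = y" using x cells_less by auto
  define r where "r = \<rho> ?u"
  have "r = ?u \<or> meq x (r mod N) (3 ^ l)" "r = ?v \<or> meq y (r mod N) (3 ^ l)"
    using s u lev eq unfolding sound_def r_def by metis+
  then consider "r = ?u" "r = ?v" | "r = ?u" "meq y (r mod N) (3 ^ l)" | "r = ?v" "meq x (r mod N) (3 ^ l)"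
    | "meq x (r mod N) (3 ^ l)" "meq y (r mod N) (3 ^ l)" by blast
  then show ?thesis
  proof cases
    case 1
    then show ?thesis using ne by simp
  next
    case 2
    then show ?thesis using lev meq_sym by simp
  next
    case 3
    then show ?thesis using lev by simp
  next
    case 4
    then show ?thesis using meq_sym meq_trans by blast
  qed
qed

lemma sound_link:
  assumes f: "uf.forest m \<rho>" and s: "sound \<rho>" and u: "u \<in> V" "v \<in> V" "lev u = lev v" "\<rho> u = u"
    and e: "meq (u mod N) (v mod N) (3 ^ lev u)"
  shows "sound (\<lambda>x. if \<rho> x = u then v else \<rho> x)"
  unfolding sound_def
proof
  fix w assume w: "w \<in> V"
  have *: "\<rho> w = w \<or> meq (w mod N) (\<rho> w mod N) (3 ^ lev w)" using s w by (auto simp: sound_def)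
  show "(if \<rho> w = u then v else \<rho> w) = w \<or> meq (w mod N) ((if \<rho> w = u then v else \<rho> w) mod N) (3 ^ lev w)"
  proof (cases "\<rho> w = u")
    case True
    then have "lev w = lev u" using uf.forestD(2)[OF f w] by simp
    then show ?thesis using * e True by (auto intro: meq_trans)
  qed (use * in simp)
qed

text \<open>The state of a query \<open>(i, j)\<close>: blocks of length \<open>3 ^ K\<close> at \<open>A\<close>, \<open>B\<close> are being compared, and within
  them sub-blocks of length \<open>3 ^ k\<close> at offset \<open>x\<close>; the blocks of the levels above \<open>k\<close> are known not to
  be in the same class yet.  Mode 0: the sub-blocks have to be compared; 1: they are equal, but
  not yet in the same class; 2: they are equal and in the same class.\<close>

definition core :: "(nat \<Rightarrow> nat) \<Rightarrow> nat \<Rightarrow> nat \<Rightarrow> nat \<Rightarrow> nat \<Rightarrow> nat \<Rightarrow> nat \<Rightarrow> nat \<Rightarrow> nat \<Rightarrow> bool" where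
  "core \<rho> i j A B x k K md \<longleftrightarrow>
     i \<noteq> j \<and> 1 \<le> i \<and> i \<le> n \<and> 1 \<le> j \<and> j \<le> n \<and> i \<le> A \<and> B + i = A + j \<and>
     k \<le> K \<and> K \<le> lmax \<and> md \<le> 2 \<and> x < 3 ^ K \<and> 3 ^ k dvd x \<and> sel K A \<and> sel K B \<and>
     meq i j (A + x - i) \<and> (md \<noteq> 0 \<longrightarrow> meq (A + x) (B + x) (3 ^ k)) \<and>
     (\<forall>l. (if md = 1 then k else Suc k) \<le> l \<longrightarrow> l \<le> K \<longrightarrow>
        \<rho> (l * N + (A + x div 3 ^ l * 3 ^ l)) \<noteq> \<rho> (l * N + (B + x div 3 ^ l * 3 ^ l)))"

lemma core_range:
  assumes "core \<rho> i j A B x k K md"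
  shows "A + x \<le> n + 1" "B + x \<le> n + 1" "A \<noteq> B" "1 \<le> A" "1 \<le> B"
    and "md \<noteq> 0 \<Longrightarrow> A + x + 3 ^ k \<le> n + 1" "md \<noteq> 0 \<Longrightarrow> B + x + 3 ^ k \<le> n + 1"
    and "x div 3 ^ k * 3 ^ k = x"
proof -
  note c = assms[unfolded core_def]
  have "meq i j (A + x - i)" using c by blast
  from meq_range[OF this] c show "A + x \<le> n + 1" "B + x \<le> n + 1" by auto
  show "A \<noteq> B" "1 \<le> A" "1 \<le> B" "x div 3 ^ k * 3 ^ k = x" using c by auto
  assume "md \<noteq> 0"
  then have "meq (A + x) (B + x) (3 ^ k)" using c by blast
  moreover have "(3::nat) ^ k - 1 < 3 ^ k" by simp
  ultimately have "eq (A + x + (3 ^ k - 1)) (B + x + (3 ^ k - 1))" unfolding meq_def by blast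
  from eq_range[OF this] eq_range[OF eq_sym[OF this]]
  show "A + x + 3 ^ k \<le> n + 1" "B + x + 3 ^ k \<le> n + 1" by auto
qed

lemma core_cells:
  assumes "core \<rho> i j A B x k K md" "l \<le> K"
  shows "A + x div 3 ^ l * 3 ^ l \<in> cells l" "B + x div 3 ^ l * 3 ^ l \<in> cells l" "l \<le> lmax"
proof -
  have "x div 3 ^ l * 3 ^ l \<le> x" by simp
  then have "A + x div 3 ^ l * 3 ^ l \<le> n + 1" "B + x div 3 ^ l * 3 ^ l \<le> n + 1"
    using core_range(1,2)[OF assms(1)] by linarith+
  then show "A + x div 3 ^ l * 3 ^ l \<in> cells l" "B + x div 3 ^ l * 3 ^ l \<in> cells l"
    using core_range(4,5)[OF assms(1)] assms sel_mono[of K _ l] unfolding cells_def core_def by auto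
  show "l \<le> lmax" using assms by (auto simp: core_def)
qed

lemma core_node:
  assumes "core \<rho> i j A B x k K md"
  shows "A + x \<in> cells k" "B + x \<in> cells k" "k \<le> lmax"
  using core_cells[OF assms, of k] core_range[OF assms] assms by (auto simp: core_def)

lemma core_same_class:
  assumes c: "core \<rho> i j A B x k K 0" and so: "sound \<rho>"
    and e: "\<rho> (k * N + (A + x)) = \<rho> (k * N + (B + x))"
  shows "core \<rho> i j A B x k K 2"
proof -
  have "meq (A + x) (B + x) (3 ^ k)"
    using sound_eq[OF so _ _ _ e] core_node[OF c] core_range[OF c] by simp
  then show ?thesis using c by (auto simp: core_def)
qed

lemma core_descend:
  assumes c: "core \<rho> i j A B x (Suc k) K 0"
    and e: "\<rho> (Suc k * N + (A + x)) \<noteq> \<rho> (Suc k * N + (B + x))"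
  shows "core \<rho> i j A B x k K 0"
proof -
  have "3 ^ k dvd x" using c by (auto simp: core_def elim: dvd_trans[rotated])
  moreover have "\<rho> (l * N + (A + x div 3 ^ l * 3 ^ l)) \<noteq> \<rho> (l * N + (B + x div 3 ^ l * 3 ^ l))"
    if "Suc k \<le> l" "l \<le> K" for l
    using that c e core_range(8)[OF c] by (cases "l = Suc k") (auto simp: core_def)
  ultimately show ?thesis using c unfolding core_def by simp
qed

lemma core_symbol_eq:
  assumes c: "core \<rho> i j A B x 0 K 0"
    and e: "\<rho> (A + x) \<noteq> \<rho> (B + x)" "eq (A + x) (B + x)"
  shows "core \<rho> i j A B x 0 K 1"
proof -
  have "\<rho> (l * N + (A + x div 3 ^ l * 3 ^ l)) \<noteq> \<rho> (l * N + (B + x div 3 ^ l * 3 ^ l))"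
    if "l \<le> K" for l
    using that c e by (cases "l = 0") (auto simp: core_def)
  moreover have "meq (A + x) (B + x) 1" using e by (auto simp: meq_def)
  ultimately show ?thesis using c unfolding core_def by simp
qed

text \<open>A link on level \<open>k\<close> reroutes classes of that level only, so the enclosing
  blocks, on levels above \<open>k\<close>, stay in distinct classes.\<close>

lemma core_link:
  assumes c: "core \<rho> i j A B x k K 1"
    and f: "uf.forest m \<rho>" and u: "u \<in> V" "lev u = k" and v: "lev v = k"
  shows "core (\<lambda>w. if \<rho> w = u then v else \<rho> w) i j A B x k K 2"
proof -
  let ?r = "\<lambda>w. if \<rho> w = u then v else \<rho> w"
  have "?r (l * N + (A + x div 3 ^ l * 3 ^ l)) \<noteq> ?r (l * N + (B + x div 3 ^ l * 3 ^ l))"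
    if l: "Suc k \<le> l" "l \<le> K" for l
  proof -
    have "lev (\<rho> (l * N + (A + x div 3 ^ l * 3 ^ l))) = l" "lev (\<rho> (l * N + (B + x div 3 ^ l * 3 ^ l))) = l"
      using core_cells[OF c l(2)] uf.forestD(2)[OF f node_in_V] cells_less lev_node by auto
    then show ?thesis using l u v c by (auto simp: core_def)
  qed
  then show ?thesis using c unfolding core_def by auto
qed

text \<open>Climbing never passes \<open>lmax\<close>: a matched block lies inside the string, so
  \<open>3 ^ K \<le> n\<close> and another level exists. For the new top blocks the condition on
  enclosing blocks is empty.\<close>

lemma core_advance:
  assumes c: "core \<rho> i j A B x K K 2"
  shows "core \<rho> i j (A + 3 ^ K) (B + 3 ^ K) 0 K K 0" "x = 0"
    and "sel (Suc K) (A + 3 ^ K) \<Longrightarrow> sel (Suc K) (B + 3 ^ K) \<Longrightarrow>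
      core \<rho> i j (A + 3 ^ K) (B + 3 ^ K) 0 (Suc K) (Suc K) 0"
proof -
  show x: "x = 0" using c by (auto simp: core_def elim!: dvdE)
  have iA: "i \<le> A" and B: "B + i = A + j" using c by (auto simp: core_def)
  have "i + (A - i) = A" "j + (A - i) = B" "A - i + 3 ^ K = A + 3 ^ K - i" using iA B by linarith+
  then have m: "meq i j (A + 3 ^ K - i)"
    using meq_add[of i j "A - i" "3 ^ K"] c x by (auto simp: core_def)
  have s: "sel K (A + 3 ^ K)" "sel K (B + 3 ^ K)" using sel_add[of K _ 1] c by (auto simp: core_def)
  show "core \<rho> i j (A + 3 ^ K) (B + 3 ^ K) 0 K K 0" using c m s unfolding core_def by auto
  have "3 ^ K \<le> n" using core_range(6)[OF c] core_range(4)[OF c] by simp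
  then have "Suc K \<le> lmax" using less_lmax[of K] by simp
  then show "core \<rho> i j (A + 3 ^ K) (B + 3 ^ K) 0 (Suc K) (Suc K) 0"
    if "sel (Suc K) (A + 3 ^ K)" "sel (Suc K) (B + 3 ^ K)"
    using c m that unfolding core_def by auto
qed

text \<open>The results for the first two thirds need not be stored: everything from
  \<open>i\<close>, \<open>j\<close> to the end of the last third matches, and this covers the
  enclosing block.\<close>

lemma core_ascend:
  assumes c: "core \<rho> i j A B x k K 2" and k: "k < K" and d: "x div 3 ^ k mod 3 = 2"
  shows "core \<rho> i j A B (x - 2 * 3 ^ k) (Suc k) K 1"
proof -
  have dv: "3 ^ k dvd x" using c by (auto simp: core_def)
  note u = div_pow_sub_up[OF dv d]
  let ?x = "x - 2 * 3 ^ k"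
  have iA: "i \<le> A" and B: "B + i = A + j" using c by (auto simp: core_def)
  have "i + (A + x - i) = A + x" "j + (A + x - i) = B + x" using iA B by linarith+
  then have "meq i j ((A + x - i) + 3 ^ k)"
    using c by (intro meq_add) (auto simp: core_def)
  then have m: "meq i j (A + x + 3 ^ k - i)" using iA by (simp add: algebra_simps)
  have "meq i j (A + ?x - i)" using meq_shift[OF m, of 0 "A + ?x - i"] by simp
  moreover have "meq (i + (A + ?x - i)) (j + (A + ?x - i)) (3 ^ Suc k)"
    using meq_shift[OF m, of "A + ?x - i" "3 ^ Suc k"] u(1) iA by simp
  moreover have "i + (A + ?x - i) = A + ?x" "j + (A + ?x - i) = B + ?x" using iA B by linarith+
  ultimately have "meq i j (A + ?x - i)" "meq (A + ?x) (B + ?x) (3 ^ Suc k)" by simp_all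
  moreover have "?x < 3 ^ K" using c unfolding core_def by linarith
  ultimately show ?thesis using c k u unfolding core_def by auto
qed

lemma core_next:
  assumes c: "core \<rho> i j A B x k K 2" and k: "k < K" and d: "x div 3 ^ k mod 3 \<noteq> 2"
  shows "core \<rho> i j A B (x + 3 ^ k) k K 0"
proof -
  have dv: "3 ^ k dvd x" using c by (auto simp: core_def)
  note u = div_pow_add_next[OF dv d]
  have iA: "i \<le> A" and B: "B + i = A + j" using c by (auto simp: core_def)
  have "i + (A + x - i) = A + x" "j + (A + x - i) = B + x" using iA B by linarith+
  then have "meq i j ((A + x - i) + 3 ^ k)"
    using c by (intro meq_add) (auto simp: core_def)
  then have m: "meq i j (A + (x + 3 ^ k) - i)" using iA by (simp add: algebra_simps)
  have "(x + 3 ^ k) div 3 ^ K = 0" unfolding u[OF k] using c by (auto simp: core_def)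
  then have "x + 3 ^ k < 3 ^ K" by (simp add: div_eq_0_iff)
  then show ?thesis using c m u dv unfolding core_def by auto
qed

text \<open>What the query has used up, in units of \<open>vc\<close>: blocks compared while climbing, finished siblings on the path of
  open blocks, the open blocks themselves, and the current one.  In mode 1 the sub-blocks just
  finished are still counted; the link that follows pays for them.\<close>

definition spent :: "nat \<Rightarrow> nat \<Rightarrow> nat \<Rightarrow> nat \<Rightarrow> nat \<Rightarrow> nat \<Rightarrow> nat" where
  "spent A B x k K md =
     (\<Sum>l<K. 6 * vc l) + 2 * (3 - climb_dist (A div 3 ^ K) (B div 3 ^ K)) * vc K +
     (\<Sum>l=k..<K. 2 * (x div 3 ^ l mod 3) * vc l) +
     (\<Sum>l=(if md = 1 then k else Suc k)..K. vc l) +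
     (if md = 2 then vc k else 0) + (if md = 1 then 6 * vc (k - 1) else 0)"

text \<open>\<open>22 = 6 + 4 + 4 + 1 + 1 + 6\<close>, one number for each term of
  \<open>spent\<close>; the digits and \<open>3 - climb_dist\<close> are at most 2.\<close>

lemma spent_bound:
  assumes "k \<le> K" "K \<le> lmax"
  shows "spent A B x k K md \<le> 22 * (\<Sum>l\<le>lmax. vc l)"
proof -
  let ?S = "\<Sum>l\<le>lmax. vc l"
  have one: "vc l \<le> ?S" if "l \<le> lmax" for l using that by (intro member_le_sum) auto
  have sub: "(\<Sum>l\<in>X. vc l) \<le> ?S" if "X \<subseteq> {..lmax}" for X using that by (intro sum_mono2) auto
  have "(\<Sum>l<K. 6 * vc l) \<le> 6 * ?S"
    unfolding sum_distrib_left[symmetric] using assms by (intro mult_le_mono2 sub) auto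
  moreover have "2 * (3 - climb_dist (A div 3 ^ K) (B div 3 ^ K)) * vc K \<le> 4 * ?S"
    using climb_dist_range[of "A div 3 ^ K" "B div 3 ^ K"] assms by (intro mult_le_mono one) auto
  moreover have "(\<Sum>l=k..<K. 2 * (x div 3 ^ l mod 3) * vc l) \<le> (\<Sum>l=k..<K. 4 * vc l)"
    by (intro sum_mono mult_le_mono1) (simp add: less_Suc_eq_le[symmetric] numeral_3_eq_3[symmetric])
  moreover have "(\<Sum>l=k..<K. 4 * vc l) \<le> 4 * ?S"
    unfolding sum_distrib_left[symmetric] using assms by (intro mult_le_mono2 sub) auto
  moreover have "(\<Sum>l=(if md = 1 then k else Suc k)..K. vc l) \<le> ?S" 
    using assms by (intro sub) auto
  moreover have "(if md = 2 then vc k else 0) \<le> ?S" "(if md = 1 then 6 * vc (k - 1) else 0) \<le> 6 * ?S"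
    using assms by (auto intro!: one)
  ultimately show ?thesis unfolding spent_def by linarith
qed

lemma spent_same_class: "spent A B x k K 0 + vc k \<le> spent A B x k K 2"
  by (simp add: spent_def)

lemma spent_descend: 
  "Suc k \<le> K \<Longrightarrow> 3 ^ Suc k dvd x \<Longrightarrow> spent A B x (Suc k) K 0 + vc (Suc k) \<le> spent A B x k K 0"
proof -
  assume k: "Suc k \<le> K" and "3 ^ Suc k dvd x"
  then have "x div 3 ^ k mod 3 = 0" by (auto simp: dvd_def)
  then have "(\<Sum>l=k..<K. 2 * (x div 3 ^ l mod 3) * vc l) = (\<Sum>l=Suc k..<K. 2 * (x div 3 ^ l mod 3) * vc l)"
    using k by (simp add: sum.atLeast_Suc_lessThan)
  moreover have "(\<Sum>l=Suc k..K. vc l) = vc (Suc k) + (\<Sum>l=Suc (Suc k)..K. vc l)"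
    using k by (simp add: sum.atLeast_Suc_atMost)
  ultimately show ?thesis by (simp add: spent_def)
qed

lemma spent_symbol_eq: "spent A B x 0 K 0 + vc 0 \<le> spent A B x 0 K 1"
  by (simp add: spent_def sum.atLeast_Suc_atMost)

text \<open>The released \<open>al k\<close> has two parts. \<open>6 * vc (k - 1)\<close> cancels
  the three sub-blocks, at two iterations each (one to compare or open, one to leave), and
  \<open>vc k\<close> pays for the linking iteration. On level 0 truncated subtraction gives the
  same \<open>6 * vc 0\<close> on both sides.\<close>

lemma spent_link: "k \<le> K \<Longrightarrow> spent A B x k K 1 + vc k \<le> spent A B x k K 2 + al k"
  by (simp add: spent_def al_def sum.atLeast_Suc_atMost)

lemma sel_Suc_add: "sel K A \<Longrightarrow> sel (Suc K) (A + 3 ^ K) \<longleftrightarrow> (A div 3 ^ K + 1) mod 3 \<noteq> 2"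
  using sel_add[of K A 1] by (simp add: sel_Suc)

text \<open>Without a climb the distance to the next one falls by 1, so the climbing term grows by
  \<open>2 * vc K\<close>: the comparison just made and the present iteration.\<close>

lemma spent_advance:
  assumes "sel K A" "sel K B" "\<not> (sel (Suc K) (A + 3 ^ K) \<and> sel (Suc K) (B + 3 ^ K))"
  shows "spent A B 0 K K 2 + vc K \<le> spent (A + 3 ^ K) (B + 3 ^ K) 0 K K 0"
proof -
  have "climb_dist (A div 3 ^ K) (B div 3 ^ K) = Suc (climb_dist (A div 3 ^ K + 1) (B div 3 ^ K + 1))"
    using assms by (intro climb_dist_Suc) (auto simp: sel_Suc_add)
  moreover define c where "c = climb_dist (A div 3 ^ K + 1) (B div 3 ^ K + 1)"
  moreover have "Suc c \<le> 3" using climb_dist_range(2)[of "A div 3 ^ K" "B div 3 ^ K"] calculation by simp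
  then have "3 - c = Suc (3 - Suc c)" by simp
  ultimately show ?thesis by (simp add: spent_def)
qed

text \<open>At most three top blocks, at two iterations each, are compared on level
  \<open>K\<close>; this is the allowance \<open>6 * vc K\<close> of a level left behind.\<close>

lemma spent_climb: "spent A B 0 K K 2 + vc K \<le> spent A' B' 0 (Suc K) (Suc K) 0"
proof -
  have "3 - climb_dist (A div 3 ^ K) (B div 3 ^ K) \<in> {0, 1, 2}"
    using climb_dist_range(1)[of "A div 3 ^ K" "B div 3 ^ K"] by auto
  then show ?thesis by (auto simp: spent_def)
qed

lemma spent_ascend:
  assumes k: "k < K" and d: "3 ^ k dvd x" "x div 3 ^ k mod 3 = 2"
  shows "spent A B x k K 2 + vc k \<le> spent A B (x - 2 * 3 ^ k) (Suc k) K 1"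
proof -
  have "(\<Sum>l=Suc k..<K. 2 * ((x - 2 * 3 ^ k) div 3 ^ l mod 3) * vc l) = (\<Sum>l=Suc k..<K. 2 * (x div 3 ^ l mod 3) * vc l)"
    using div_pow_sub_up(3)[OF d] by (intro sum.cong) auto
  moreover have "(\<Sum>l=k..<K. 2 * (x div 3 ^ l mod 3) * vc l) = 4 * vc k + (\<Sum>l=Suc k..<K. 2 * (x div 3 ^ l mod 3) * vc l)"
    using k d by (simp add: sum.atLeast_Suc_lessThan)
  ultimately show ?thesis by (simp add: spent_def)
qed

lemma spent_next:
  assumes k: "k < K" and d: "3 ^ k dvd x" "x div 3 ^ k mod 3 \<noteq> 2"
  shows "spent A B x k K 2 + vc k \<le> spent A B (x + 3 ^ k) k K 0"
proof -
  have "(\<Sum>l=Suc k..<K. 2 * ((x + 3 ^ k) div 3 ^ l mod 3) * vc l) = (\<Sum>l=Suc k..<K. 2 * (x div 3 ^ l mod 3) * vc l)"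
    using div_pow_add_next[OF d] by (intro sum.cong) auto
  moreover have "(x + 3 ^ k) div 3 ^ k mod 3 = Suc (x div 3 ^ k mod 3)"
    using d(2) by (simp add: mod_Suc)
  ultimately show ?thesis using k by (simp add: spent_def sum.atLeast_Suc_lessThan algebra_simps)
qed

end

section \<open>The query program and the effect of each of its actions\<close>

definition find_at :: "nat \<Rightarrow> nat \<Rightarrow> com" where
  "find_at x a = Seq (Binop x Add a 12) (Seq (Binop x Add x 14) (find_root x 22 23))"

definition locate :: com where
  "locate = Seq (find_at 20 10) (find_at 21 11)"

definition digit_is_2 :: "nat \<Rightarrow> nat \<Rightarrow> com" where
  "digit_is_2 z x = Seq (Binop z Div x 13) (Seq (Binop z Mod z 7) (Binop z Equal z 6))"

definition compare :: com where
  "compare =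
    Seq (Binop 24 Equal 20 21) (Cond 24 (Const 15 2)
    (Seq (Binop 24 Equal 13 5) (Cond 24
      (Seq (Binop 22 Add 10 12) (Seq (Binop 23 Add 11 12) (Seq (SymEq 24 22 23)
        (Cond 24 (Const 15 1) (Const 16 0)))))
      (Seq (Binop 13 Div 13 7) (Binop 14 Sub 14 3)))))"

definition advance :: com where
  "advance =
    Seq (Binop 10 Add 10 13) (Seq (Binop 11 Add 11 13) (Seq (Const 15 0)
    (Seq (digit_is_2 24 10) (Seq (digit_is_2 23 11) (Seq (Binop 24 Add 24 23) (Cond 24 Skip
      (Seq (Binop 13 Mul 13 7) (Seq (Copy 17 13) (Binop 14 Add 14 3)))))))))"

definition leave_block :: com where
  "leave_block =
    Seq (Binop 24 Equal 13 17) (Cond 24 advance (Seq (digit_is_2 24 12) (Cond 24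
      (Seq (Binop 12 Sub 12 13) (Seq (Binop 12 Sub 12 13) (Seq (Binop 13 Mul 13 7)
        (Seq (Binop 14 Add 14 3) (Const 15 1)))))
      (Seq (Binop 12 Add 12 13) (Const 15 0)))))"

definition act :: com where
  "act = Cond 15 (Seq (Binop 24 Equal 15 5) (Cond 24 (Seq link_roots (Const 15 2)) leave_block)) compare"

text \<open>The case \<open>i = j\<close> is separate: a block equals itself also beyond the end of the string, so the
  loop would not stop.\<close>

definition query_prog :: com where
  "query_prog =
    Seq (Binop 24 Equal 1 2) (Cond 24 (Binop 0 Sub 8 1)
    (Seq (Copy 10 1) (Seq (Copy 11 2) (Seq (Const 12 0) (Seq (Const 13 1) (Seq (Const 14 0)
    (Seq (Const 15 0) (Seq (Const 16 1) (Seq (Const 17 1) (Seq (While 16 (Seq locate act))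
    (Seq (Binop 0 Add 10 12) (Binop 0 Sub 0 1))))))))))))"

definition prep_prog :: com where
  "prep_prog =
    Seq (Const 5 1) (Seq (Const 6 2) (Seq (Const 7 3) (Seq (Binop 3 Add 0 6)
    (Seq (Binop 8 Add 0 5) (Binop 4 Mul 3 3)))))"

lemma set_reg_set_reg: "set_reg x v (set_reg x v' s) = set_reg x v s"
  by (simp add: set_reg_def)

lemma wp_digit_is_2:
  assumes "reg s 6 = 2" "reg s 7 = 3" "reg s x < 2 ^ W" "3 < (2::nat) ^ W" "z \<notin> {6, 7}"
  shows "wp W eq (digit_is_2 z x) s Q \<longleftrightarrow> Q (1 + (1 + 1)) 0 (set_reg z (of_bool (reg s x div reg s 13 mod 3 = 2)) s)"
proof -
  have lt: "reg s x div reg s 13 < 2 ^ W"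
    using assms(3) by (rule le_less_trans[OF div_le_dividend])
  have "reg s x div reg s 13 mod 3 < 3" by simp
  then have "reg s x div reg s 13 mod 3 < 2 ^ W" using assms(4) by linarith
  moreover have "0 < W" using assms(4) by (cases W) auto
  ultimately show ?thesis using lt assms by (simp add: digit_is_2_def set_reg_set_reg)
qed

lemma wrap_sub: "b \<le> a \<Longrightarrow> a < m \<Longrightarrow> (m + a - b) mod m = a - (b::nat)"
  by (metis Nat.add_diff_assoc2 add.commute diff_le_self le_less_trans mod_add_self2 mod_less)

context lce
begin

definition consts_ok :: "state \<Rightarrow> bool" where
  "consts_ok s \<longleftrightarrow> reg s 3 = N \<and> reg s 4 = off \<and> reg s 5 = 1 \<and> reg s 6 = 2 \<and> reg s 7 = 3 \<and> reg s 8 = n + 1"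

definition config :: "state \<Rightarrow> nat \<Rightarrow> nat \<Rightarrow> nat \<Rightarrow> nat \<Rightarrow> nat \<Rightarrow> nat \<Rightarrow> nat \<Rightarrow> nat \<Rightarrow> bool" where
  "config s i A B x k K md run \<longleftrightarrow> consts_ok s \<and> reg s 1 = i \<and>
     reg s 10 = A \<and> reg s 11 = B \<and> reg s 12 = x \<and> reg s 13 = 3 ^ k \<and> reg s 14 = k * N \<and>
     reg s 15 = md \<and> reg s 16 = run \<and> reg s 17 = 3 ^ K"

lemma word_bounds: "12 * N \<le> 2 ^ W" "4 * off \<le> 2 ^ W" "(1::nat) < 2 ^ W" "(2::nat) < 2 ^ W" "(3::nat) < 2 ^ W" "0 < W"
proof -
  have "3 * N \<le> N * N" unfolding N_def using n_pos by (intro mult_le_mono1) simp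
  then show 1: "12 * N \<le> 2 ^ W" using word by linarith
  show "4 * off \<le> 2 ^ W" using word by (simp add: off_def)
  have "2 \<le> N" by (simp add: N_def)
  then show "(1::nat) < 2 ^ W" "(2::nat) < 2 ^ W" "(3::nat) < 2 ^ W" using 1 by linarith+
  then show "0 < W" by (cases W) auto
qed

lemma level_bound: "k \<le> lmax \<Longrightarrow> x < N \<Longrightarrow> k * N + x < 2 ^ W"
  using node_less_off[of k x] word_bounds(2) by linarith

lemma wp_find_at:
  assumes f: "uf.forest (mem s) \<rho>" and u: "u = k * N + (reg s a + reg s 12)" "reg s 14 = k * N"
    and c: "reg s a + reg s 12 \<in> cells k" "k \<le> lmax" and x: "x \<notin> {12, 14, 22, 23}"
  shows "wp W eq (find_at x a) s (\<lambda>t e s'. e = 0 \<and> uf.forest (mem s') \<rho> \<and>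
     (\<forall>l. uf.roots (mem s') l = uf.roots (mem s) l) \<and> reg s' x = \<rho> u \<and>
     (\<forall>r. r \<notin> {x, 22, 23} \<longrightarrow> reg s' r = reg s r) \<and> uf.Phi (mem s') \<le> uf.Phi (mem s) \<and>
     t + 10 * uf.Phi (mem s') \<le> 10 * uf.Phi (mem s) + 10 * vc k)"
proof -
  have b: "u < 2 ^ W" using level_bound[OF c(2)] cells_less[OF c(1)] u by simp
  have V: "u \<in> V" using node_in_V c u by simp
  have lev: "lev u = k" using cells_less[OF c(1)] u by simp
  \<comment> \<open>The 2 to spare turns the additive 12 of the search and the two address
    computations into part of \<open>10 * vc k\<close>.\<close>
  have g: "grp k rmax + 2 \<le> vc k" by (rule grp_le) simp
  let ?s = "set_reg x u (set_reg x (reg s a + reg s 12) s)"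
  have "wp W eq (find_at x a) s Q \<longleftrightarrow> wp W eq (find_root x 22 23) ?s (\<lambda>t e s'. Q (1 + (1 + t)) (0 + (0 + e)) s')" for Q
    using b x u by (simp add: find_at_def ac_simps)
  moreover have "wp W eq (find_root x 22 23) ?s (\<lambda>t e s'. (0 + (0 + e)) = 0 \<and> uf.forest (mem s') \<rho> \<and>
     (\<forall>l. uf.roots (mem s') l = uf.roots (mem s) l) \<and> reg s' x = \<rho> u \<and>
     (\<forall>r. r \<notin> {x, 22, 23} \<longrightarrow> reg s' r = reg s r) \<and> uf.Phi (mem s') \<le> uf.Phi (mem s) \<and>
     1 + (1 + t) + 10 * uf.Phi (mem s') \<le> 10 * uf.Phi (mem s) + 10 * vc k)"
    by (rule wp_mono[OF uf.wp_find_root[of ?s \<rho> u x 22 23]]) (use f V x g in \<open>auto simp: lev\<close>)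
  ultimately show ?thesis by blast
qed

lemma wp_locate:
  assumes f: "uf.forest (mem s) \<rho>" and c: "config s i A B x k K md 1"
    and x: "A + x \<in> cells k" "B + x \<in> cells k" "k \<le> lmax"
  shows "wp W eq locate s (\<lambda>t e s'. e = 0 \<and> uf.forest (mem s') \<rho> \<and>
     (\<forall>l. uf.roots (mem s') l = uf.roots (mem s) l) \<and>
     reg s' 20 = \<rho> (k * N + (A + x)) \<and> reg s' 21 = \<rho> (k * N + (B + x)) \<and>
     config s' i A B x k K md 1 \<and> uf.Phi (mem s') \<le> uf.Phi (mem s) \<and>
     t + 10 * uf.Phi (mem s') \<le> 10 * uf.Phi (mem s) + 20 * vc k)"
  unfolding locate_def wp_Seq
proof (rule wp_mono[OF wp_find_at[OF f, of "k * N + (A + x)" k 10 20]], goal_cases)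
  case (6 t e s')
  then have c': "config s' i A B x k K md 1" using c by (simp add: config_def consts_ok_def)
  show ?case
  proof (rule wp_mono[OF wp_find_at[of s' \<rho> "k * N + (B + x)" k 11 21]], goal_cases)
    case (7 t' e' s'')
    then have "config s'' i A B x k K md 1" using c' by (simp add: config_def consts_ok_def)
    then show ?case using 6 7 by simp
  qed (use 6 c' x in \<open>auto simp: config_def\<close>)
qed (use c x in \<open>auto simp: config_def\<close>)

lemma wp_compare_same:
  assumes c: "config s i A B x k K 0 1" and e: "reg s 20 = reg s 21"
  shows "wp W eq act s (\<lambda>t e s'. t \<le> 22 \<and> e = 0 \<and> mem s' = mem s \<and> config s' i A B x k K 2 1)"
  using c e word_bounds by (simp add: act_def compare_def config_def consts_ok_def)

lemma wp_compare_descend: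
  assumes c: "config s i A B x (Suc k) K 0 1" and e: "reg s 20 \<noteq> reg s 21" and b: "Suc k \<le> lmax"
  shows "wp W eq act s (\<lambda>t e s'. t \<le> 22 \<and> e = 0 \<and> mem s' = mem s \<and> config s' i A B x k K 0 1)"
proof -
  have "(3::nat) ^ Suc k \<le> 3 ^ lmax" using b by (intro power_increasing) auto
  then have "3 ^ k < (2::nat) ^ W" using lmax_le(1) word_bounds(1) by (simp add: N_def)
  moreover have "N + k * N < 2 ^ W" using level_bound[OF b, of 0] by simp
  then have "(2 ^ W + (N + k * N) - N) mod 2 ^ W = k * N" by (subst wrap_sub) auto
  ultimately show ?thesis
    using c e word_bounds by (simp add: act_def compare_def config_def consts_ok_def)
qed

lemma wp_compare_symbols:
  assumes c: "config s i A B x 0 K 0 1" and e: "reg s 20 \<noteq> reg s 21" and b: "A + x < N" "B + x < N"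
  shows "wp W eq act s (\<lambda>t e s'. t \<le> 22 \<and> e = 1 \<and> mem s' = mem s \<and>
     (if eq (A + x) (B + x) then config s' i A B x 0 K 1 1 else config s' i A B x 0 K 0 0))"
proof -
  have "A + x < 2 ^ W" "B + x < 2 ^ W" using b word_bounds by linarith+
  then show ?thesis
    using c e word_bounds by (simp add: act_def compare_def config_def consts_ok_def)
qed

lemma pow3_bound: "k \<le> lmax \<Longrightarrow> 3 * 3 ^ k < (2::nat) ^ W"
proof -
  assume "k \<le> lmax"
  then have "(3::nat) ^ k \<le> 3 ^ lmax" by (intro power_increasing) auto
  moreover have "9 * n < 12 * N" by (simp add: N_def)
  ultimately show ?thesis using lmax_le(1) word_bounds(1) by linarith
qed

lemma wp_advance:
  assumes c: "config s i A B x K K 2 1" and b: "A + 3 ^ K \<le> n + 1" "B + 3 ^ K \<le> n + 1" "K < lmax"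
    and sel: "sel K A" "sel K B"
  shows "wp W eq act s (\<lambda>t e s'. t \<le> 22 \<and> e = 0 \<and> mem s' = mem s \<and>
     (if sel (Suc K) (A + 3 ^ K) \<and> sel (Suc K) (B + 3 ^ K)
      then config s' i (A + 3 ^ K) (B + 3 ^ K) x (Suc K) (Suc K) 0 1
      else config s' i (A + 3 ^ K) (B + 3 ^ K) x K K 0 1))"
proof -
  have w: "A + 3 ^ K < 2 ^ W" "B + 3 ^ K < 2 ^ W" using b word_bounds(1) by (simp_all add: N_def)
  have l: "K * N + N < 2 ^ W" using level_bound[of "Suc K" 0] b by simp
  have s: "sel (Suc K) (A + 3 ^ K) \<longleftrightarrow> (A + 3 ^ K) div 3 ^ K mod 3 \<noteq> 2"
    "sel (Suc K) (B + 3 ^ K) \<longleftrightarrow> (B + 3 ^ K) div 3 ^ K mod 3 \<noteq> 2"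
    using sel sel_add[of K _ 1] by (auto simp: sel_Suc)
  have p: "3 ^ K * 3 < (2::nat) ^ W" using pow3_bound[of K] b(3) by simp
  show ?thesis
    using c w l p word_bounds(3-6)
    unfolding s act_def leave_block_def advance_def
    by (simp add: wp_digit_is_2 config_def consts_ok_def add.commute[of N] mult.commute[of 3] del: div_add_self2)
qed

lemma wp_ascend:
  assumes c: "config s i A B x k K 2 1" and k: "k < K" "K \<le> lmax" and d: "3 ^ k dvd x" "x div 3 ^ k mod 3 = 2" "x < 2 ^ W"
  shows "wp W eq act s (\<lambda>t e s'. t \<le> 22 \<and> e = 0 \<and> mem s' = mem s \<and> config s' i A B (x - 2 * 3 ^ k) (Suc k) K 1 1)"
proof -
  have x: "2 * 3 ^ k \<le> x" using div_pow_sub_up(1)[OF d(1,2)] .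
  have 1: "(2 ^ W + x - 3 ^ k) mod 2 ^ W = x - 3 ^ k" using x d(3) by (intro wrap_sub) auto
  have 2: "(2 ^ W + (x - 3 ^ k) - 3 ^ k) mod 2 ^ W = x - 2 * 3 ^ k" using x d(3) by (subst wrap_sub) auto
  have l: "k * N + N < 2 ^ W" using level_bound[of "Suc k" 0] k by simp
  have p: "3 ^ k * 3 < (2::nat) ^ W" using pow3_bound[of k] k by simp
  show ?thesis
    using c l p k word_bounds(3-6) d(2,3) 1 2
    by (simp add: act_def leave_block_def wp_digit_is_2 config_def consts_ok_def
        add.commute[of N] mult.commute[of 3])
qed

lemma wp_next:
  assumes c: "config s i A B x k K 2 1" and k: "k < K" and d: "x div 3 ^ k mod 3 \<noteq> 2" "x + 3 ^ k < 2 ^ W"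
  shows "wp W eq act s (\<lambda>t e s'. t \<le> 22 \<and> e = 0 \<and> mem s' = mem s \<and> config s' i A B (x + 3 ^ k) k K 0 1)"
proof -
  have x: "x < 2 ^ W" using d(2) by linarith
  show ?thesis
    using c x k word_bounds(3-6) d
    by (simp add: act_def leave_block_def wp_digit_is_2 config_def consts_ok_def)
qed

end

lemma length_longest_common_prefix:
  assumes "\<forall>t<d. t < length xs \<and> t < length ys \<and> xs ! t = ys ! t"
    and "\<not> (d < length xs \<and> d < length ys \<and> xs ! d = ys ! d)"
  shows "length (longest_common_prefix xs ys) = d"
  using assms
proof (induction xs ys arbitrary: d rule: longest_common_prefix.induct)
  case (1 x xs y ys)
  show ?case
  proof (cases d)
    case 0
    then show ?thesis using 1(3) by auto
  next
    case (Suc d')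
    then have "x = y" using 1(2) by force
    moreover have "\<forall>t<d'. t < length xs \<and> t < length ys \<and> xs ! t = ys ! t"
      using 1(2) Suc by fastforce
    ultimately show ?thesis using 1 Suc by auto
  qed
next
  case ("2_1" ys)
  then have "\<not> 0 < d" by fastforce
  then show ?case by simp
next
  case ("2_2" xs)
  then have "\<not> 0 < d" by fastforce
  then show ?case by simp
qed

section \<open>One iteration, one query, a sequence of queries\<close>

context lce
begin

definition running :: "state \<Rightarrow> (nat \<Rightarrow> nat) \<Rightarrow> nat \<Rightarrow> nat \<Rightarrow> nat \<Rightarrow> nat \<Rightarrow> nat \<Rightarrow> nat \<Rightarrow> nat \<Rightarrow> nat \<Rightarrow> bool" where
  "running s \<rho> i j A B x k K md \<longleftrightarrow>
     config s i A B x k K md 1 \<and> uf.forest (mem s) \<rho> \<and> sound \<rho> \<and> core \<rho> i j A B x k K md"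

text \<open>What gets linked are the representatives, so the equality found for two blocks has to be
  carried over to these.\<close>

lemma sound_rep:
  assumes s: "sound \<rho>" and u: "u \<in> V" "v \<in> V" "lev u = lev v"
    and e: "meq (u mod N) (v mod N) (3 ^ lev u)"
  shows "meq (\<rho> u mod N) (\<rho> v mod N) (3 ^ lev u)"
proof -
  have r: "\<rho> u = u \<or> meq (u mod N) (\<rho> u mod N) (3 ^ lev u)"
    "\<rho> v = v \<or> meq (v mod N) (\<rho> v mod N) (3 ^ lev u)"
    using s u by (auto simp: sound_def)
  have "meq (\<rho> u mod N) (v mod N) (3 ^ lev u)"
    using r(1) by (rule disjE) (use e meq_trans[OF meq_sym e] in \<open>auto intro: meq_trans[OF meq_sym]\<close>)
  then show ?thesis using r(2) by (auto intro: meq_trans)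
qed

text \<open>A successful test is paid by the link of the following iteration, which removes a root
  of level 0; \<open>of_bool (md = 1 \<and> k = 0)\<close> is the debt in between. The second
  alternative is the mismatch that ends the query, the one test that no link pays for.\<close>

definition step_post :: "state \<Rightarrow> nat \<Rightarrow> nat \<Rightarrow> nat \<Rightarrow> nat \<Rightarrow> nat \<Rightarrow> nat \<Rightarrow> nat \<Rightarrow> nat \<Rightarrow> nat \<Rightarrow> nat \<Rightarrow> state \<Rightarrow> bool" where
  "step_post s i j A B x k K md t e s' \<longleftrightarrow>
     (\<exists>\<rho>' A' B' x' k' K' md'. running s' \<rho>' i j A' B' x' k' K' md' \<and>
        t + 1 + 40 * uf.Phi (mem s') + 40 * spent A B x k K md \<le> 40 * uf.Phi (mem s) + 40 * spent A' B' x' k' K' md' \<and>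
        e + card (uf.roots (mem s') 0) + of_bool (md = 1 \<and> k = 0) \<le> card (uf.roots (mem s) 0) + of_bool (md' = 1 \<and> k' = 0)) \<or>
     (\<exists>\<rho>'. config s' i A B x 0 K 0 0 \<and> uf.forest (mem s') \<rho>' \<and> sound \<rho>' \<and> md = 0 \<and> k = 0 \<and> \<not> eq (A + x) (B + x) \<and>
        t + 1 + 40 * uf.Phi (mem s') \<le> 40 * uf.Phi (mem s) + 40 * vc k \<and>
        e + card (uf.roots (mem s') 0) \<le> card (uf.roots (mem s) 0) + 1)"

lemma step_postI:
  assumes "running s' \<rho>' i j A' B' x' k' K' md'"
    and "t + 1 + 40 * uf.Phi (mem s') \<le> 40 * uf.Phi (mem s) + 40 * vc k"
    and "spent A B x k K md + vc k \<le> spent A' B' x' k' K' md'"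
    and "e + card (uf.roots (mem s') 0) + of_bool (md = 1 \<and> k = 0) \<le> card (uf.roots (mem s) 0) + of_bool (md' = 1 \<and> k' = 0)"
  shows "step_post s i j A B x k K md t e s'"
proof -
  have "t + 1 + 40 * uf.Phi (mem s') + 40 * spent A B x k K md \<le> 40 * uf.Phi (mem s) + 40 * spent A' B' x' k' K' md'"
    using assms(2,3) by linarith
  then show ?thesis unfolding step_post_def using assms(1,4) by blast
qed

lemma wp_act_link:
  assumes c: "config s i A B x k K 1 1" and r: "running s \<rho> i j A B x k K 1"
    and l: "reg s 20 = \<rho> (k * N + (A + x))" "reg s 21 = \<rho> (k * N + (B + x))"
  shows "wp W eq act s (\<lambda>t e s'. e = 0 \<and> t \<le> 22 \<and> (\<exists>\<rho>'. running s' \<rho>' i j A B x k K 2 \<and>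
     uf.Phi (mem s') + al k \<le> uf.Phi (mem s) \<and>
     card (uf.roots (mem s') 0) + of_bool (k = 0) \<le> card (uf.roots (mem s) 0)))"
proof -
  let ?u = "k * N + (A + x)" and ?v = "k * N + (B + x)"
  have f: "uf.forest (mem s) \<rho>" and so: "sound \<rho>" and co: "core \<rho> i j A B x k K 1"
    using r by (auto simp: running_def)
  note cn = core_node[OF co]
  have u: "?u \<in> V" "?v \<in> V" using node_in_V cn by auto
  have lev: "lev ?u = k" "lev ?v = k" "?u mod N = A + x" "?v mod N = B + x" using cn cells_less by auto
  note fu = uf.forestD[OF f u(1)] and fv = uf.forestD[OF f u(2)]
  have ne: "\<rho> ?u \<noteq> \<rho> ?v" using co core_range(8)[OF co] by (auto simp: core_def)
  have me: "meq (\<rho> ?u mod N) (\<rho> ?v mod N) (3 ^ k)"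
    using sound_rep[OF so u] co lev by (simp add: core_def)
  have ro: "\<rho> (\<rho> ?u) = \<rho> ?u" "\<rho> (\<rho> ?v) = \<rho> ?v"
    using uf.forestD(5)[OF f fu(1) fu(3)] uf.forestD(5)[OF f fv(1) fv(3)] by auto
  let ?s = "set_reg 24 1 s"
  have "wp W eq act s Q \<longleftrightarrow> wp W eq link_roots ?s (\<lambda>t e s'. Q (1 + (t + 1 + 1) + 1) (0 + (e + 0)) (set_reg 15 2 s'))" for Q
    using c word_bounds(3-6) by (simp add: act_def config_def consts_ok_def)
  moreover have "wp W eq link_roots ?s (\<lambda>t e s'. 0 + (e + 0) = 0 \<and> 1 + (t + 1 + 1) + 1 \<le> 22 \<and>
     (\<exists>\<rho>'. running (set_reg 15 2 s') \<rho>' i j A B x k K 2 \<and>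
     uf.Phi (mem (set_reg 15 2 s')) + al k \<le> uf.Phi (mem s) \<and>
     card (uf.roots (mem (set_reg 15 2 s')) 0) + of_bool (k = 0) \<le> card (uf.roots (mem s) 0)))"
  proof (rule wp_mono[OF uf.wp_link_roots[of ?s \<rho> W eq]])
    show "uf.forest (mem ?s) \<rho>" "reg ?s 20 \<in> V" "mem ?s (reg ?s 20) = 0" "reg ?s 21 \<in> V"
      "mem ?s (reg ?s 21) = 0" "reg ?s 20 \<noteq> reg ?s 21" "lev (reg ?s 20) = lev (reg ?s 21)"
      using f fu fv l ne lev by simp_all
    show "2 * off \<le> 2 ^ W" using word_bounds by linarith
    show "rmax < off" using rmax_le_n by (simp add: off_def N_def)
    show "reg ?s 4 = off" "reg ?s 5 = 1" using c by (simp_all add: config_def consts_ok_def)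
    fix t e :: nat and s' :: state
    assume *: "e = 0 \<and> t \<le> 12 \<and> (\<forall>r. r \<notin> {22, 23, 24} \<longrightarrow> reg s' r = reg ?s r) \<and>
      (\<exists>\<rho>' u v. (u = reg ?s 20 \<and> v = reg ?s 21 \<or> u = reg ?s 21 \<and> v = reg ?s 20) \<and>
       \<rho>' = (\<lambda>x. if \<rho> x = u then v else \<rho> x) \<and> uf.forest (mem s') \<rho>' \<and> 
       (\<forall>l. uf.roots (mem s') l = uf.roots (mem ?s) l - {u}) \<and> uf.Phi (mem s') + al (lev (reg ?s 20)) \<le> uf.Phi (mem ?s))"
    then obtain \<rho>' p q where pq: "p = \<rho> ?u \<and> q = \<rho> ?v \<or> p = \<rho> ?v \<and> q = \<rho> ?u"
      and \<rho>': "\<rho>' = (\<lambda>x. if \<rho> x = p then q else \<rho> x)" and f': "uf.forest (mem s') \<rho>'"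
      and rt: "\<And>l. uf.roots (mem s') l = uf.roots (mem s) l - {p}" 
      and ph: "uf.Phi (mem s') + al k \<le> uf.Phi (mem s)"
      using l fu lev by auto
    have p: "p \<in> V" "q \<in> V" "lev p = k" "lev q = k" "\<rho> p = p" "mem s p = 0" "meq (p mod N) (q mod N) (3 ^ k)"
      using pq fu fv lev ro me meq_sym by auto
    have "sound \<rho>'" unfolding \<rho>' using sound_link[OF f so p(1,2)] p by simp
    moreover have "core \<rho>' i j A B x k K 2" unfolding \<rho>' by (rule core_link[OF co f p(1,3,4)])
    moreover have "config (set_reg 15 2 s') i A B x k K 2 1" using * c by (simp add: config_def consts_ok_def)
    ultimately have "running (set_reg 15 2 s') \<rho>' i j A B x k K 2" using f' by (simp add: running_def)
    moreover have "card (uf.roots (mem s') 0) + of_bool (k = 0) \<le> card (uf.roots (mem s) 0)"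
    proof (cases "k = 0")
      case True
      then have "p \<in> uf.roots (mem s) 0" using p by (simp add: uf.roots_def)
      from card_Suc_Diff1[OF uf.finite_roots this] show ?thesis unfolding rt using True by simp
    next
      case False
      then show ?thesis unfolding rt using card_Diff1_le[of "uf.roots (mem s) 0" p] by simp
    qed
    ultimately show "0 + (e + 0) = 0 \<and> 1 + (t + 1 + 1) + 1 \<le> 22 \<and>
     (\<exists>\<rho>'. running (set_reg 15 2 s') \<rho>' i j A B x k K 2 \<and>
     uf.Phi (mem (set_reg 15 2 s')) + al k \<le> uf.Phi (mem s) \<and>
     card (uf.roots (mem (set_reg 15 2 s')) 0) + of_bool (k = 0) \<le> card (uf.roots (mem s) 0))"
      using ph * by auto
  qed
  ultimately show ?thesis by blast
qed

lemma wp_step: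
  assumes r: "running s \<rho> i j A B x k K md"
  shows "wp W eq (Seq locate act) s (step_post s i j A B x k K md)"
proof -
  have c: "config s i A B x k K md 1" and f: "uf.forest (mem s) \<rho>" and so: "sound \<rho>"
    and co: "core \<rho> i j A B x k K md" using r by (auto simp: running_def)
  have kK: "k \<le> K" "K \<le> lmax" and dv: "3 ^ k dvd x" and xK: "x < 3 ^ K" and md: "md = 0 \<or> md = 1 \<or> md = 2"
    and selK: "sel K A" "sel K B" using co by (auto simp: core_def)
  note rg = core_range[OF co]
  have vc2: "2 \<le> vc k" by (simp add: vc_def)
  show ?thesis unfolding wp_Seq
  proof (rule wp_mono[OF wp_locate[OF f c core_node[OF co]]], elim conjE)
    fix t1 e1 :: nat and s1 :: state
    assume e1: "e1 = 0" and f1: "uf.forest (mem s1) \<rho>" and rt: "\<forall>l. uf.roots (mem s1) l = uf.roots (mem s) l"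
      and l: "reg s1 20 = \<rho> (k * N + (A + x))" "reg s1 21 = \<rho> (k * N + (B + x))"
      and c1: "config s1 i A B x k K md 1" and P: "uf.Phi (mem s1) \<le> uf.Phi (mem s)"
      and T: "t1 + 10 * uf.Phi (mem s1) \<le> 10 * uf.Phi (mem s) + 20 * vc k"
    \<comment> \<open>Two searches take \<open>20 * vc k\<close>. The other \<open>20 * vc k\<close>
      is at least 40 because \<open>2 \<le> vc k\<close>, and covers the 22 steps of
      \<open>act\<close> and the loop test.\<close>
    have time: "t1 + t2 + 1 + 40 * uf.Phi (mem s2) \<le> 40 * uf.Phi (mem s) + 40 * vc k"
      if "t2 \<le> 22" "mem s2 = mem s1" for t2 :: nat and s2 :: state
      using that P T vc2 by simp
    have post: "step_post s i j A B x k K md (t1 + t2) (e1 + e2) s2"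
      if "t2 \<le> 22 \<and> e2 = 0 \<and> mem s2 = mem s1 \<and> config s2 i A' B' x' k' K' md' 1"
        "core \<rho> i j A' B' x' k' K' md'" "spent A B x k K md + vc k \<le> spent A' B' x' k' K' md'" "md \<noteq> 1"
      for t2 e2 :: nat and s2 :: state and A' B' x' k' K' md'
      by (rule step_postI[where \<rho>' = \<rho>, OF _ time that(3)]) (use that f1 so rt e1 in \<open>auto simp: running_def\<close>)
    show "wp W eq act s1 (\<lambda>t2 e2. step_post s i j A B x k K md (t1 + t2) (e1 + e2))"
    proof (cases "md = 0")
      case m0: True
      note c10 = c1[unfolded m0] and co0 = co[unfolded m0]
      show ?thesis
      proof (cases "reg s1 20 = reg s1 21")
        case True
        have "core \<rho> i j A B x k K 2" using core_same_class[OF co0 so] True l by simp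
        then show ?thesis
          by (intro wp_mono[OF wp_compare_same[OF c10 True]] post) (use m0 spent_same_class in auto)
      next
        case ne: False
        show ?thesis
        proof (cases k)
          case (Suc k')
          have d: "core \<rho> i j A B x k' K 0" using core_descend[of \<rho> i j A B x k' K] co0 ne l Suc by simp
          have sp: "spent A B x k K 0 + vc k \<le> spent A B x k' K 0" 
            using spent_descend[of k' K x A B] kK dv Suc by simp
          show ?thesis
            by (rule wp_mono[OF wp_compare_descend[OF c10[unfolded Suc] ne]], use kK Suc in simp)
               (rule post, use m0 sp d in auto)
        next
          case 0
          note c00 = c10[unfolded 0]
          have b: "A + x < N" "B + x < N" using rg by (auto simp: N_def)
          show ?thesis
          proof (rule wp_mono[OF wp_compare_symbols[OF c00 ne b]])
            fix t2 e2 :: nat and s2 :: state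
            assume *: "t2 \<le> 22 \<and> e2 = 1 \<and> mem s2 = mem s1 \<and>
              (if eq (A + x) (B + x) then config s2 i A B x 0 K 1 1 else config s2 i A B x 0 K 0 0)"
            show "step_post s i j A B x k K md (t1 + t2) (e1 + e2) s2"
            proof (cases "eq (A + x) (B + x)")
              case True
              have "core \<rho> i j A B x 0 K 1" using core_symbol_eq[OF co0[unfolded 0]] ne l True 0 by simp
              then have "running s2 \<rho> i j A B x 0 K 1" using True * f1 so by (simp add: running_def)
              then show ?thesis
                by (rule step_postI[OF _ time]) (use * rt e1 0 m0 spent_symbol_eq in auto)
            next
              case False
              then show ?thesis unfolding step_post_def
                using * time[of t2 s2] f1 so 0 m0 rt e1 by auto
            qed
          qed
        qed
      qed
    next
      case m0: False
      show ?thesis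
      proof (cases "md = 1")
        case m1: True
        have r1: "running s1 \<rho> i j A B x k K 1" using c1 f1 so co m1 by (simp add: running_def)
        show ?thesis
        proof (rule wp_mono[OF wp_act_link[OF c1[unfolded m1] r1 l]], elim conjE exE)
          fix t2 e2 :: nat and s2 :: state and \<rho>'
          assume *: "e2 = 0" "t2 \<le> 22" "running s2 \<rho>' i j A B x k K 2"
            "uf.Phi (mem s2) + al k \<le> uf.Phi (mem s1)"
            "card (uf.roots (mem s2) 0) + of_bool (k = 0) \<le> card (uf.roots (mem s1) 0)"
          \<comment> \<open>Here \<open>time\<close> is used for the memory before the link; the
            drop of \<open>Phi\<close> by \<open>al k\<close> is then added through
            \<open>spent_link\<close>.\<close>
          have "t1 + t2 + 1 + 40 * uf.Phi (mem s2) + 40 * spent A B x k K md \<le> 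
            40 * uf.Phi (mem s) + 40 * spent A B x k K 2"
            using time[OF *(2) refl] *(4) spent_link[OF kK(1), of A B x] unfolding m1 by linarith
          moreover have "e1 + e2 + card (uf.roots (mem s2) 0) + of_bool (md = 1 \<and> k = 0)
            \<le> card (uf.roots (mem s) 0) + of_bool ((2::nat) = 1 \<and> k = 0)"
            using * e1 m1 rt by simp
          ultimately show "step_post s i j A B x k K md (t1 + t2) (e1 + e2) s2"
            unfolding step_post_def using *(3) by blast
        qed
      next
        case False
        then have m2: "md = 2" using md m0 by auto
        note c12 = c1[unfolded m2] and co2 = co[unfolded m2]
        show ?thesis
        proof (cases "k = K")
          case True
          note ca = core_advance[OF co2[unfolded True]]
          have x0: "x = 0" by (rule ca)
          have le: "A + 3 ^ K \<le> n + 1" "B + 3 ^ K \<le> n + 1" using rg(6,7) m2 x0 True by auto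
          then have "3 ^ K \<le> n" using rg(4) by simp
          then have "K < lmax" by (rule less_lmax)
          show ?thesis
          proof (rule wp_mono[OF wp_advance[OF c12[unfolded True] le \<open>K < lmax\<close> selK]])
            fix t2 e2 :: nat and s2 :: state
            assume *: "t2 \<le> 22 \<and> e2 = 0 \<and> mem s2 = mem s1 \<and>
              (if sel (Suc K) (A + 3 ^ K) \<and> sel (Suc K) (B + 3 ^ K)
               then config s2 i (A + 3 ^ K) (B + 3 ^ K) x (Suc K) (Suc K) 0 1
               else config s2 i (A + 3 ^ K) (B + 3 ^ K) x K K 0 1)"
            show "step_post s i j A B x k K md (t1 + t2) (e1 + e2) s2"
            proof (cases "sel (Suc K) (A + 3 ^ K) \<and> sel (Suc K) (B + 3 ^ K)")
              case up: True
              have "spent A B x k K md + vc k \<le> spent (A + 3 ^ K) (B + 3 ^ K) 0 (Suc K) (Suc K) 0"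
                using spent_climb True x0 m2 by simp
              then show ?thesis 
                by (intro post[where A' = "A + 3 ^ K" and B' = "B + 3 ^ K" and x' = 0 and k' = "Suc K" and K' = "Suc K" and md' = 0])
                   (use * up ca(3) x0 m2 in auto)
            next
              case stay: False
              have "spent A B x k K md + vc k \<le> spent (A + 3 ^ K) (B + 3 ^ K) 0 K K 0"
                using spent_advance[OF selK stay] True x0 m2 by simp
              then show ?thesis 
                by (intro post[where A' = "A + 3 ^ K" and B' = "B + 3 ^ K" and x' = 0 and k' = K and K' = K and md' = 0])
                   (use * stay ca(1) x0 m2 in auto)
            qed
          qed
        next
          case False
          then have kl: "k < K" using kK by simp
          have xb: "x < 2 ^ W" using rg(1) word_bounds(1) by (simp add: N_def)
          show ?thesis
          proof (cases "x div 3 ^ k mod 3 = 2")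
            case True
            show ?thesis
              by (intro wp_mono[OF wp_ascend[OF c12 kl kK(2) dv True xb]] post)
                 (use core_ascend[OF co2 kl True] spent_ascend[OF kl dv True, of A B] m2 in auto)
          next
            case False
            have "x + 3 ^ k < 2 ^ W" using rg(6) m2 word_bounds(1) by (simp add: N_def)
            then show ?thesis
              by (intro wp_mono[OF wp_next[OF c12 kl False]] post)
                 (use core_next[OF co2 kl False] spent_next[OF kl dv False, of A B] m2 in auto)
          qed
        qed
      qed
    qed
  qed
qed

definition ready :: "state \<Rightarrow> bool" where
  "ready s \<longleftrightarrow> consts_ok s \<and> (\<exists>\<rho>. uf.forest (mem s) \<rho> \<and> sound \<rho>)"

text \<open>Reflexivity of \<open>eq\<close> is not assumed, so a query with \<open>i = j\<close>
  cannot be specified by its first mismatch.\<close>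

definition answer :: "nat \<Rightarrow> nat \<Rightarrow> nat \<Rightarrow> bool" where
  "answer i j d \<longleftrightarrow> i = j \<and> d = n + 1 - i \<or> meq i j d \<and> \<not> eq (i + d) (j + d)"

lemma wp_loop:
  assumes r: "running s \<rho> i j A B x k K 0"
  defines "S \<equiv> \<Sum>l\<le>lmax. vc l"
  shows "wp W eq (While 16 (Seq locate act)) s (\<lambda>t e s'. ready s' \<and> reg s' 1 = i \<and>
     i \<le> reg s' 10 + reg s' 12 \<and> reg s' 10 + reg s' 12 \<le> n + 1 \<and> 
     answer i j (reg s' 10 + reg s' 12 - i) \<and>
     t + 40 * uf.Phi (mem s') \<le> 40 * uf.Phi (mem s) + 920 * S + 1 \<and>
     e + card (uf.roots (mem s') 0) \<le> card (uf.roots (mem s) 0) + 1)"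
proof -
  let ?P = "\<lambda>s. uf.Phi (mem s)" and ?R = "\<lambda>s. card (uf.roots (mem s) 0)"
  \<comment> \<open>\<open>920 = 40 * (22 + 1)\<close>: \<open>spent_bound\<close>, and one more
    \<open>vc 0 \<le> S\<close> for the iteration that meets the mismatch.\<close>
  define I where "I t e s' \<longleftrightarrow>
    (\<exists>\<rho> A B x k K md. running s' \<rho> i j A B x k K md \<and> t + 40 * ?P s' \<le> 40 * ?P s + 40 * spent A B x k K md \<and>
       e + ?R s' \<le> ?R s + of_bool (md = 1 \<and> k = 0)) \<or>
    (\<exists>\<rho> \<rho>0 A B x K. config s' i A B x 0 K 0 0 \<and> uf.forest (mem s') \<rho> \<and> sound \<rho> \<and>
       core \<rho>0 i j A B x 0 K 0 \<and> \<not> eq (A + x) (B + x) \<and>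
       t + 40 * ?P s' \<le> 40 * ?P s + 920 * S \<and> e + ?R s' \<le> ?R s + 1)" for t e :: nat and s' :: state
  have sb: "spent A B x k K md \<le> 22 * S" if "core \<rho> i j A B x k K md" for \<rho> A B x k K md
    unfolding S_def by (rule spent_bound) (use that in \<open>auto simp: core_def\<close>)
  have v0: "vc 0 \<le> S" unfolding S_def by (intro member_le_sum) auto
  show ?thesis
  proof (rule wp_While[where I = I and B = "40 * ?P s + 920 * S"])
    show "I 0 0 s" using r unfolding I_def by fastforce
    show "t \<le> 40 * ?P s + 920 * S" if I: "I t e s'" for t e s'
      using I unfolding I_def
    proof (elim disjE exE conjE)
      fix \<rho> A B x k K md assume "running s' \<rho> i j A B x k K md" 
        "t + 40 * ?P s' \<le> 40 * ?P s + 40 * spent A B x k K md"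
      then show ?thesis using sb[of \<rho> A B x k K md] by (simp add: running_def)
    qed simp
    fix t e :: nat and s' :: state assume I: "I t e s'"
    {
      assume "reg s' 16 \<noteq> 0"
      then obtain \<rho> A B x k K md where *: "running s' \<rho> i j A B x k K md" 
        "t + 40 * ?P s' \<le> 40 * ?P s + 40 * spent A B x k K md"
        "e + ?R s' \<le> ?R s + of_bool (md = 1 \<and> k = 0)"
        using I unfolding I_def by (auto simp: config_def)
      have co: "core \<rho> i j A B x k K md" using *(1) by (simp add: running_def)
      show "wp W eq (Seq locate act) s' (\<lambda>t' e' s'. I (t + t' + 1) (e + e') s')"
      proof (rule wp_mono[OF wp_step[OF *(1)]])
        fix t' e' s'' assume "step_post s' i j A B x k K md t' e' s''"
        then show "I (t + t' + 1) (e + e') s''"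
          unfolding step_post_def
        proof (elim disjE exE conjE)
          fix \<rho>' A' B' x' k' K' md' 
          assume a: "running s'' \<rho>' i j A' B' x' k' K' md'"
            "t' + 1 + 40 * ?P s'' + 40 * spent A B x k K md \<le> 40 * ?P s' + 40 * spent A' B' x' k' K' md'"
            "e' + ?R s'' + of_bool (md = 1 \<and> k = 0) \<le> ?R s' + of_bool (md' = 1 \<and> k' = 0)"
          have "t + t' + 1 + 40 * ?P s'' \<le> 40 * ?P s + 40 * spent A' B' x' k' K' md'"
            using * a by linarith
          moreover have "e + e' + ?R s'' \<le> ?R s + of_bool (md' = 1 \<and> k' = 0)" using * a by linarith
          ultimately show ?thesis unfolding I_def using a(1) by blast
        next
          fix \<rho>'
          assume a: "config s'' i A B x 0 K 0 0" "uf.forest (mem s'') \<rho>'" "sound \<rho>'"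
            "md = 0" "k = 0" "\<not> eq (A + x) (B + x)"
            "t' + 1 + 40 * ?P s'' \<le> 40 * ?P s' + 40 * vc k" "e' + ?R s'' \<le> ?R s' + 1"
          have "t + t' + 1 + 40 * ?P s'' \<le> 40 * ?P s + 920 * S"
            using *(2) a(5,7) sb[OF co] v0 by simp
          moreover have "e + e' + ?R s'' \<le> ?R s + 1" using *(3) a by simp
          moreover have "core \<rho> i j A B x 0 K 0" using co a by simp
          ultimately show ?thesis unfolding I_def using a by blast
        qed
      qed
    }
    assume "reg s' 16 = 0"
    then obtain \<rho> \<rho>0 A B x K where *: "config s' i A B x 0 K 0 0" "uf.forest (mem s') \<rho>" "sound \<rho>"
       "core \<rho>0 i j A B x 0 K 0" "\<not> eq (A + x) (B + x)"
       "t + 40 * ?P s' \<le> 40 * ?P s + 920 * S" "e + ?R s' \<le> ?R s + 1"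
      using I unfolding I_def by (auto simp: config_def running_def)
    have c: "i \<le> A" "B + i = A + j" "meq i j (A + x - i)" using *(4) by (auto simp: core_def)
    have "i + (A + x - i) = A + x" "j + (A + x - i) = B + x" using c by linarith+
    then have "answer i j (A + x - i)" unfolding answer_def using c *(5) by simp
    moreover have "ready s'" using * by (auto simp: ready_def config_def)
    ultimately show "ready s' \<and> reg s' 1 = i \<and>
     i \<le> reg s' 10 + reg s' 12 \<and> reg s' 10 + reg s' 12 \<le> n + 1 \<and> 
     answer i j (reg s' 10 + reg s' 12 - i) \<and>
     t + 1 + 40 * uf.Phi (mem s') \<le> 40 * uf.Phi (mem s) + 920 * S + 1 \<and>
     e + card (uf.roots (mem s') 0) \<le> card (uf.roots (mem s) 0) + 1"
      using *(1,6,7) c(1) core_range(1)[OF *(4)] by (simp add: config_def)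
  qed
qed

lemma wp_query:
  assumes r: "ready s" and ij: "reg s 1 = i" "reg s 2 = j" "1 \<le> i" "i \<le> n" "1 \<le> j" "j \<le> n"
  defines "S \<equiv> \<Sum>l\<le>lmax. vc l"
  shows "wp W eq query_prog s (\<lambda>t e s'. ready s' \<and> answer i j (reg s' 0) \<and>
     t + 40 * uf.Phi (mem s') \<le> 40 * uf.Phi (mem s) + 930 * S \<and>
     e + card (uf.roots (mem s') 0) \<le> card (uf.roots (mem s) 0) + 1)"
proof -
  from r obtain \<rho> where c: "consts_ok s" and f: "uf.forest (mem s) \<rho>" "sound \<rho>" by (auto simp: ready_def)
  have "vc 0 \<le> S" unfolding S_def by (intro member_le_sum) auto
  \<comment> \<open>This lets \<open>10 * S\<close> absorb the 12 steps outside the loop and the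
    final loop test, which turns 920 into 930.\<close>
  then have S2: "2 \<le> S" by (simp add: vc_def)
  have n1: "n + 1 < 2 ^ W" using word_bounds(1) by (simp add: N_def)
  show ?thesis
  proof (cases "i = j")
    case True
    have "(2 ^ W + (n + 1) - i) mod 2 ^ W = n + 1 - i" using ij n1 by (subst wrap_sub) auto
    then show ?thesis using True ij c f S2 word_bounds(3-6)
      by (auto simp: query_prog_def ready_def consts_ok_def answer_def)
  next
    case False
    define s1 where "s1 = set_reg 17 1 (set_reg 16 1 (set_reg 15 0 (set_reg 14 0 (set_reg 13 1
      (set_reg 12 0 (set_reg 11 j (set_reg 10 i (set_reg 24 0 s))))))))"
    have "core \<rho> i j i j 0 0 0 0" using False ij by (simp add: core_def)
    then have r1: "running s1 \<rho> i j i j 0 0 0 0"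
      using f c ij by (simp add: running_def config_def consts_ok_def s1_def)
    have t12: "t + 12 = Suc (Suc (Suc (Suc (Suc (Suc (Suc (Suc (Suc (Suc (Suc (Suc t)))))))))))" for t by simp
    have "wp W eq query_prog s Q \<longleftrightarrow> wp W eq (While 16 (Seq locate act)) s1 (\<lambda>t e s'. Q (t + 12) e
       (set_reg 0 (binop_val W Sub (binop_val W Add (reg s' 10) (reg s' 12)) (reg s' 1)) s'))" for Q
      using False ij c word_bounds(3-6)
      by (simp add: query_prog_def s1_def consts_ok_def set_reg_set_reg t12)
    moreover have "wp W eq (While 16 (Seq locate act)) s1 (\<lambda>t e s'. 
      ready (set_reg 0 (binop_val W Sub (binop_val W Add (reg s' 10) (reg s' 12)) (reg s' 1)) s') \<and>
      answer i j (reg (set_reg 0 (binop_val W Sub (binop_val W Add (reg s' 10) (reg s' 12)) (reg s' 1)) s') 0) \<and>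
      t + 12 + 40 * uf.Phi (mem (set_reg 0 (binop_val W Sub (binop_val W Add (reg s' 10) (reg s' 12)) (reg s' 1)) s'))
        \<le> 40 * uf.Phi (mem s) + 930 * S \<and>
      e + card (uf.roots (mem (set_reg 0 (binop_val W Sub (binop_val W Add (reg s' 10) (reg s' 12)) (reg s' 1)) s')) 0)
        \<le> card (uf.roots (mem s) 0) + 1)"
    proof (rule wp_mono[OF wp_loop[OF r1]], elim conjE)
      fix t e :: nat and s' :: state
      assume *: "ready s'" "reg s' 1 = i" "i \<le> reg s' 10 + reg s' 12" "reg s' 10 + reg s' 12 \<le> n + 1"
        "answer i j (reg s' 10 + reg s' 12 - i)"
        "t + 40 * uf.Phi (mem s') \<le> 40 * uf.Phi (mem s1) + 920 * sum vc {..lmax} + 1"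
        "e + card (uf.roots (mem s') 0) \<le> card (uf.roots (mem s1) 0) + 1"
      have "binop_val W Sub (binop_val W Add (reg s' 10) (reg s' 12)) (reg s' 1) = reg s' 10 + reg s' 12 - i"
        using *(2,3,4) n1 by (simp add: wrap_sub)
      moreover have "ready (set_reg 0 v s')" for v using *(1) by (simp add: ready_def consts_ok_def)
      moreover have "mem s1 = mem s" by (simp add: s1_def)
      ultimately show "ready (set_reg 0 (binop_val W Sub (binop_val W Add (reg s' 10) (reg s' 12)) (reg s' 1)) s') \<and>
      answer i j (reg (set_reg 0 (binop_val W Sub (binop_val W Add (reg s' 10) (reg s' 12)) (reg s' 1)) s') 0) \<and>
      t + 12 + 40 * uf.Phi (mem (set_reg 0 (binop_val W Sub (binop_val W Add (reg s' 10) (reg s' 12)) (reg s' 1)) s'))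
        \<le> 40 * uf.Phi (mem s) + 930 * S \<and>
      e + card (uf.roots (mem (set_reg 0 (binop_val W Sub (binop_val W Add (reg s' 10) (reg s' 12)) (reg s' 1)) s')) 0)
        \<le> card (uf.roots (mem s) 0) + 1"
        using *(5,6,7) S2 unfolding S_def[symmetric] by simp
    qed
    ultimately show ?thesis by blast
  qed
qed

text \<open>Each query bounds cost plus what remains of a resource, \<open>Phi\<close> for time and
  the roots of level 0 for tests, so the bounds telescope along the sequence.\<close>

lemma serve_queries:
  assumes "ready s" "set qs \<subseteq> {1..n} \<times> {1..n}"
  shows "\<exists>as t e. serve W eq query_prog s qs as t e \<and> list_all2 (\<lambda>(i, j) d. answer i j d) qs as \<and>
     t \<le> 40 * uf.Phi (mem s) + length qs * (930 * (\<Sum>l\<le>lmax. vc l)) \<and>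
     e \<le> card (uf.roots (mem s) 0) + length qs"
  using assms
proof (induction qs arbitrary: s)
  case Nil
  then show ?case using serve.Nil by fastforce
next
  case (Cons p qs)
  obtain i j where p: "p = (i, j)" by (cases p)
  let ?s = "set_reg 1 i (set_reg 2 j s)"
  have "ready ?s" using Cons.prems(1) by (simp add: ready_def consts_ok_def)
  moreover have "1 \<le> i" "i \<le> n" "1 \<le> j" "j \<le> n" using Cons.prems(2) p by auto
  ultimately obtain t e s' where 1: "exec W eq query_prog ?s t e s'" "ready s'" "answer i j (reg s' 0)"
    "t + 40 * uf.Phi (mem s') \<le> 40 * uf.Phi (mem s) + 930 * (\<Sum>l\<le>lmax. vc l)"
    "e + card (uf.roots (mem s') 0) \<le> card (uf.roots (mem s) 0) + 1"
    using wp_query[of ?s i j] by (auto simp: wp_def)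
  from Cons.IH[OF 1(2)] Cons.prems(2) obtain as t' e' where 2: "serve W eq query_prog s' qs as t' e'"
    "list_all2 (\<lambda>(i, j) d. answer i j d) qs as"
    "t' \<le> 40 * uf.Phi (mem s') + length qs * (930 * (\<Sum>l\<le>lmax. vc l))"
    "e' \<le> card (uf.roots (mem s') 0) + length qs" by auto
  have "serve W eq query_prog s (p # qs) (reg s' 0 # as) (t + t') (e + e')"
    unfolding p by (rule serve.Cons[OF 1(1) 2(1)])
  moreover have "t + t' \<le> 40 * uf.Phi (mem s) + length (p # qs) * (930 * (\<Sum>l\<le>lmax. vc l))"
    using 1(4) 2(3) by simp
  moreover have "e + e' \<le> card (uf.roots (mem s) 0) + length (p # qs)" using 1(5) 2(4) by simp
  moreover have "list_all2 (\<lambda>(i, j) d. answer i j d) (p # qs) (reg s' 0 # as)" using 2(2) 1(3) p by simp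
  ultimately show ?case by blast
qed

lemma card_initial_roots: "card (uf.roots (\<lambda>_. 0) l) \<le> n + 1"
proof -
  have "uf.roots (\<lambda>_. 0) l \<subseteq> (\<lambda>x. l * N + x) ` {1..n + 1}"
  proof
    fix u assume u: "u \<in> uf.roots (\<lambda>_. 0) l"
    then obtain l' x where x: "u = l' * N + x" "x \<in> cells l'" by (auto simp: uf.roots_def V_iff)
    then have "l' = l" using u cells_less lev_node by (auto simp: uf.roots_def)
    then show "u \<in> (\<lambda>x. l * N + x) ` {1..n + 1}" using x by (auto simp: cells_def)
  qed
  then have "card (uf.roots (\<lambda>_. 0) l) \<le> card ((\<lambda>x. l * N + x) ` {1..n + 1})"
    by (intro card_mono) auto
  also have "\<dots> \<le> n + 1" using card_image_le[of "{1..n + 1}" "\<lambda>x. l * N + x"] by simp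
  finally show ?thesis .
qed

text \<open>Memory filled with zeros already is the forest of singletons of rank 0, so only
  constants have to be set up.\<close>

lemma wp_prep:
  "wp W eq prep_prog (init_state n) (\<lambda>t e s. t \<le> 6 \<and> e = 0 \<and> ready s \<and> mem s = (\<lambda>_. 0))"
proof -
  have "uf.forest (\<lambda>_. 0) (\<lambda>u. u)"
    unfolding uf.forest_def using card_initial_roots by simp
  moreover have "sound (\<lambda>u. u)" by (simp add: sound_def)
  moreover have "N < 2 ^ W" "N * N < 2 ^ W" "n + 1 < 2 ^ W"
    using word_bounds(1,2) N_pos unfolding off_def by (simp_all add: N_def)
  ultimately show ?thesis using word_bounds(3-6)
    by (auto simp: prep_prog_def init_state_def ready_def consts_ok_def N_def off_def)
qed

lemma Phi_initial: "uf.Phi (\<lambda>_. 0) = Phi0"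
  by (simp add: uf.Phi_def uf.phi_def Phi0_def)

end

section \<open>From the query's answer to \<open>LCE\<close>, and the final bounds\<close>

lemma LCE_answer:
  assumes "lce (length w) (symbol_eq w) W" and ij: "i \<in> {1..length w}" "j \<in> {1..length w}"
    and a: "lce.answer (length w) (symbol_eq w) i j d"
  shows "LCE w i j = d"
proof -
  interpret lce "length w" "symbol_eq w" W by fact
  show ?thesis
  proof (cases "i = j \<and> d = length w + 1 - i")
    case True
    have "longest_common_prefix xs xs = xs" for xs :: "'a list" by (induction xs) auto
    then show ?thesis using True ij by (auto simp: LCE_def suffix_from_def)
  next
    case False
    then have m: "meq i j d" "\<not> symbol_eq w (i + d) (j + d)" using a by (auto simp: answer_def)
    \<comment> \<open>Tests off the string are negative, so the end of a suffix shows up as a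
      mismatch like any other.\<close>
    have s: "symbol_eq w (i + t) (j + t) \<longleftrightarrow> t < length (drop (i - 1) w) \<and> t < length (drop (j - 1) w) \<and>
       drop (i - 1) w ! t = drop (j - 1) w ! t" for t
      using ij by (auto simp: symbol_eq_def)
    show ?thesis unfolding LCE_def suffix_from_def
      by (rule length_longest_common_prefix) (use m in \<open>simp_all only: meq_def s, simp_all\<close>)
  qed
qed

theorem theorem18:
  shows "\<exists>(prep :: com) (query :: com) (c :: nat) (C :: real). c \<ge> 1 \<and>
    (\<forall>(w :: 'a list) (qs :: (nat \<times> nat) list) (W :: nat) (n :: nat) (q :: nat).
       n = length w \<longrightarrow> n \<ge> 1 \<longrightarrow> q = length qs \<longrightarrow>
       set qs \<subseteq> {1..n} \<times> {1..n} \<longrightarrow>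
       real c * log 2 (real n + 1) \<le> real W \<longrightarrow>
       (\<exists>t e. run_queries W prep query w qs (map (\<lambda>(i, j). LCE w i j) qs) t e \<and>
          real e \<le> C * (real n + real q) \<and>
          (n \<ge> 2 \<longrightarrow>
             real t \<le> C * (real q * log 2 (real n) + real n * real (log_star (real n))))))"
proof (rule exI[of _ prep_prog], rule exI[of _ query_prog], rule exI[of _ 6], rule exI[of _ 40000], intro conjI allI impI)
  fix w :: "'a list" and qs :: "(nat \<times> nat) list" and W n q :: nat
  assume n: "n = length w" "1 \<le> n" and q: "q = length qs" and qs: "set qs \<subseteq> {1..n} \<times> {1..n}"
    and W: "real 6 * log 2 (real n + 1) \<le> real W"
  have "lce n (symbol_eq w) W"
  proof
    show "1 \<le> n" by fact
    show "symbol_eq w p q \<Longrightarrow> symbol_eq w q p" for p q by (auto simp: symbol_eq_def)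
    show "symbol_eq w p q \<Longrightarrow> symbol_eq w q r \<Longrightarrow> symbol_eq w p r" for p q r by (auto simp: symbol_eq_def)
    show "symbol_eq w p q \<Longrightarrow> 1 \<le> p \<and> p \<le> n" for p q by (auto simp: symbol_eq_def n)
    have "real ((n + 1) ^ 6) = (real n + 1) powr real 6"
      by (subst powr_realpow) (simp_all add: add.commute)
    also have "\<dots> = (2 powr log 2 (real n + 1)) powr real 6" by simp
    also have "\<dots> = 2 powr (real 6 * log 2 (real n + 1))" by (simp only: powr_powr mult.commute)
    also have "\<dots> \<le> 2 powr real W" using W by (intro powr_mono) auto
    also have "\<dots> = real (2 ^ W)" by (simp add: powr_realpow)
    finally have "(n + 1) ^ 6 \<le> 2 ^ W" by (simp only: of_nat_le_iff)
    \<comment> \<open>The factor 6 of the word length is chosen for this: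
      \<open>4 * (n + 2)\<^sup>2 \<le> 16 * (n + 1)\<^sup>2\<close>, and \<open>(n + 1) ^ 4\<close>
      is at least 16.\<close>
    moreover have "4 * ((n + 2) * (n + 2)) \<le> (n + 1) ^ 6"
    proof -
      have "2 ^ 4 \<le> (n + 1) ^ 4" using n by (intro power_mono) auto
      then have "16 * (n + 1)\<^sup>2 \<le> (n + 1) ^ 4 * (n + 1)\<^sup>2" by (intro mult_right_mono) auto
      moreover have "(n + 1) ^ 4 * (n + 1)\<^sup>2 = (n + 1) ^ 6" by (simp flip: power_add)
      moreover have "(n + 2) * (n + 2) \<le> (2 * (n + 1)) * (2 * (n + 1))" by (intro mult_mono) auto
      moreover have "(2 * (n + 1)) * (2 * (n + 1)) = 4 * (n + 1)\<^sup>2" by (simp add: power2_eq_square)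
      ultimately show ?thesis by linarith
    qed
    ultimately show "4 * (sizes.N n * sizes.N n) \<le> 2 ^ W"
      by (simp add: sizes.N_def[OF sizes.intro[OF n(2)]])
  qed
  then interpret lce n "symbol_eq w" W .
  obtain t1 s where 1: "exec W (symbol_eq w) prep_prog (init_state n) t1 0 s" "t1 \<le> 6" "ready s" "mem s = (\<lambda>_. 0)"
    using wp_prep by (auto simp: wp_def)
  obtain as t2 e2 where 2: "serve W (symbol_eq w) query_prog s qs as t2 e2" 
    "list_all2 (\<lambda>(i, j) d. answer i j d) qs as"
    "t2 \<le> 40 * Phi0 + length qs * (930 * (\<Sum>l\<le>lmax. vc l))" "e2 \<le> n + 1 + length qs"
    using serve_queries[OF 1(3) qs] card_initial_roots[of 0] unfolding 1(4) Phi_initial by force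
  have "as = map (\<lambda>(i, j). LCE w i j) qs"
  proof (rule nth_equalityI)
    show "length as = length (map (\<lambda>(i, j). LCE w i j) qs)" using list_all2_lengthD[OF 2(2)] by simp
    fix h assume h: "h < length as"
    then have hq: "h < length qs" using list_all2_lengthD[OF 2(2)] by simp
    obtain i j where ij: "qs ! h = (i, j)" by (cases "qs ! h")
    have "(i, j) \<in> {1..n} \<times> {1..n}" using qs nth_mem[OF hq] ij by auto
    moreover have "answer i j (as ! h)" using list_all2_nthD[OF 2(2) hq] ij by simp
    ultimately show "as ! h = map (\<lambda>(i, j). LCE w i j) qs ! h"
      using LCE_answer[of w W i j "as ! h"] lce_axioms hq ij n by simp
  qed
  then have "run_queries W prep_prog query_prog w qs (map (\<lambda>(i, j). LCE w i j) qs) (t1 + t2) e2"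
    unfolding run_queries_def using 1(1) 2(1) n by force
  moreover have "real e2 \<le> real (40000 * (n + q))"
    unfolding of_nat_le_iff using 2(4) n(2) q by simp
  then have "real e2 \<le> 40000 * (real n + real q)" by simp
  moreover have "real (t1 + t2) \<le> 40000 * (real q * log 2 (real n) + real n * real (log_star (real n)))" if "2 \<le> n"
  proof -
    have L: "1 \<le> log_star (real n)" by (rule log_star_pos[OF that])
    define l where "l = real (log_star (real n))"
    have l: "1 \<le> l" "real gmax \<le> l" using L gmax_le_log_star by (auto simp: l_def)
    have nl: "1 \<le> real n * l" using l(1) n(2) mult_mono[of 1 "real n" 1 l] by simp
    have "real Phi0 \<le> real n * (120 * real gmax + 240)" by (rule Phi0_bound)
    also have "\<dots> \<le> real n * (360 * l)" using l by (intro mult_left_mono) auto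
    finally have P: "real Phi0 \<le> 360 * (real n * l)" by simp
    have "real (length qs * (930 * (\<Sum>l\<le>lmax. vc l))) = 930 * (real q * real (\<Sum>l\<le>lmax. vc l))"
      by (simp add: q)
    also have "\<dots> \<le> 930 * (real q * (24 * log 2 (real n)))"
      using sum_vc_bound[OF that] by (intro mult_left_mono) auto
    finally have Q: "real (length qs * (930 * (\<Sum>l\<le>lmax. vc l))) \<le> 22320 * (real q * log 2 (real n))" by simp
    \<comment> \<open>Here \<open>14400 = 40 * 360\<close> and \<open>22320 = 930 * 24\<close>; the
      6 steps of preparation are absorbed by \<open>1 \<le> real n * l\<close>, and 40000 is a round
      number above both.\<close>
    have "real (t1 + t2) \<le> real (6 + (40 * Phi0 + length qs * (930 * (\<Sum>l\<le>lmax. vc l))))"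
      unfolding of_nat_le_iff using 1(2) 2(3) by linarith
    also have "\<dots> \<le> 6 + 14400 * (real n * l) + 22320 * (real q * log 2 (real n))"
      using P Q by (simp only: of_nat_add of_nat_mult[of 40 Phi0])
    also have "\<dots> \<le> 40000 * (real q * log 2 (real n) + real n * l)"
    proof -
      have "0 \<le> real q * log 2 (real n)" using that by (intro mult_nonneg_nonneg) auto
      then show ?thesis using nl by (simp add: algebra_simps)
    qed
    finally show ?thesis unfolding l_def .
  qed
  ultimately show "\<exists>t e. run_queries W prep_prog query_prog w qs (map (\<lambda>(i, j). LCE w i j) qs) t e \<and>
          real e \<le> 40000 * (real n + real q) \<and>
          (n \<ge> 2 \<longrightarrow>
             real t \<le> 40000 * (real q * log 2 (real n) + real n * real (log_star (real n))))"
    by blast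
qed simp

end
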